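(* Let $p$ be a prime, let $L$ be a field of characteristic $p$ with a fixed algebraic closure $\overline{L}$, and let $\overline{\mathbb{F}}_p$ denote the algebraic closure of $\mathbb{F}_p$ inside $\overline{L}$. Let $f(x)=c_1x^{d_1}+c_2x^{d_2}\in\overline{\mathbb{F}}_p[x]$ with $c_1,c_2\in\overline{\mathbb{F}}_p^*$, $1\le d_1<d_2$, and write $d_i=p^{\ell_i}s_i$ with integers $\ell_i\ge0$ and $p\nmid s_i$. Assume $(s_1,s_2)=(2,1)$. Let $\alpha,\beta\in L$. Then $\mathrm{Prep}(f;\alpha,\beta)$ is infinite if and only if $\alpha,\beta\in\overline{\mathbb{F}}_p$ or $f(\alpha)=f(\beta)$.
   Context: For $\lambda\in\overline{L}$ let $f_\lambda(x):=f(x)+\lambda$. An element is preperiodic under $f_\lambda$ if its forward orbit under $f_\lambda$ is finite. $\mathrm{Prep}(f;\alpha,\beta)$ is the set of $\lambda\in\overline{L}$ such that both $\alpha$ and $\beta$ are preperiodic under $f_\lambda$. *)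

theory Defs
  imports "HOL-Computational_Algebra.Computational_Algebra"
begin

definition is_subfield :: "'k::field set \<Rightarrow> bool" where
  "is_subfield K \<longleftrightarrow> 0 \<in> K \<and> 1 \<in> K \<and>
     (\<forall>x\<in>K. \<forall>y\<in>K. x + y \<in> K \<and> x * y \<in> K) \<and>
     (\<forall>x\<in>K. - x \<in> K \<and> inverse x \<in> K)"

definition algebraic_over :: "'k::field set \<Rightarrow> 'k \<Rightarrow> bool" where
  "algebraic_over K x \<longleftrightarrow> (\<exists>q::'k poly. q \<noteq> 0 \<and> (\<forall>i. coeff q i \<in> K) \<and> poly q x = 0)"

text \<open>The type \<open>'k\<close> is an algebraic closure of its subset \<open>K\<close>; that \<open>'k\<close> is algebraically
  closed is part of the sort constraint.\<close>

definition algebraic_closure_of :: "'k::alg_closed_field set \<Rightarrow> bool" where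
  "algebraic_closure_of K \<longleftrightarrow> is_subfield K \<and> (\<forall>x. algebraic_over K x)"

text \<open>In characteristic \<open>p > 0\<close>, the set \<open>range of_int\<close> is the prime field with \<open>p\<close> elements
  (in characteristic 0 it is only a subring), so that the following is the algebraic closure of
  that prime field inside \<open>'k\<close>.\<close>

definition Fp_bar :: "'k::field set" where
  "Fp_bar = {x. algebraic_over (range of_int) x}"

definition preperiodic :: "('k \<Rightarrow> 'k) \<Rightarrow> 'k \<Rightarrow> bool" where
  "preperiodic g x \<longleftrightarrow> finite (range (\<lambda>n. (g ^^ n) x))"

definition Prep :: "'k::field poly \<Rightarrow> 'k \<Rightarrow> 'k \<Rightarrow> 'k set" where
  "Prep f \<alpha> \<beta> = {c. preperiodic (\<lambda>x. poly f x + c) \<alpha> \<and> preperiodic (\<lambda>x. poly f x + c) \<beta>}"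

end

theory Submission
  imports Defs
begin

text \<open>Write \<open>f(x) = c\<^sub>2 x\<^sup>q\<^sup>r + c\<^sub>1 x\<^sup>2\<^sup>q\<close> with \<open>q\<close> and \<open>r \<ge> 3\<close> powers of the odd prime \<open>p\<close>, so that
  \<open>f(x) - f(y) = c\<^sub>2 (x - y)\<^sup>q\<^sup>r + c\<^sub>1 ((x - y) (x + y))\<^sup>q\<close>, and let \<open>D = f(\<alpha>) - f(\<beta>)\<close>. Consider a
  valuation with \<open>|\<alpha>| > 1\<close>. If \<open>\<alpha>\<close> and \<open>\<beta>\<close> are preperiodic for the parameters \<open>c\<close> and \<open>c'\<close>, then
  \<open>|D|\<close> and \<open>|c - c'|\<close> are at most \<open>|\<alpha>|\<^sup>1\<^sup>/\<^sup>(\<^sup>r\<^sup>-\<^sup>1\<^sup>)\<close>, not both are equal to it, and if one is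
  smaller, it is at most \<open>|\<alpha>|\<close> to the power \<open>- 1 + 1 / (q (r - 1))\<close>. Hence \<open>|D (c - c')| < 1\<close> unless
  \<open>(q, r) = (1, 3)\<close>; in that case the same holds with \<open>D\<^sup>5\<close> times the Vandermonde product of four
  parameters. If \<open>|\<alpha>| \<le> 1\<close>, everything is integral. An element that is integral at all valuations is
  algebraic over the prime field, hence zero or of absolute value 1 everywhere. Since \<open>|\<alpha>| > 1\<close>
  for some valuation unless \<open>\<alpha>\<close> is algebraic over the prime field, the product is 0, so \<open>D = 0\<close>.\<close>

section \<open>Valuation rings\<close>

definition is_subring :: "'a::comm_ring_1 set \<Rightarrow> bool" where
  "is_subring R \<longleftrightarrow> 1 \<in> R \<and> (\<forall>x\<in>R. \<forall>y\<in>R. x - y \<in> R \<and> x * y \<in> R)"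

definition polys_over :: "'a::comm_ring_1 set \<Rightarrow> 'a poly set" where
  "polys_over R = {g. \<forall>i. coeff g i \<in> R}"

definition adjoin :: "'a::comm_ring_1 set \<Rightarrow> 'a \<Rightarrow> 'a set" where
  "adjoin R z = (\<lambda>g. poly g z) ` polys_over R"

context
  fixes R :: "'a::comm_ring_1 set"
  assumes R: "is_subring R"
begin

lemma subring_one: "1 \<in> R"
  and subring_diff: "x \<in> R \<Longrightarrow> y \<in> R \<Longrightarrow> x - y \<in> R"
  and subring_mult: "x \<in> R \<Longrightarrow> y \<in> R \<Longrightarrow> x * y \<in> R"
  using R by (auto simp: is_subring_def)

lemma subring_zero: "0 \<in> R"
  using subring_diff[OF subring_one subring_one] by simp

lemma subring_uminus: "x \<in> R \<Longrightarrow> - x \<in> R"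
  using subring_diff[OF subring_zero] by simp

lemma subring_add: "x \<in> R \<Longrightarrow> y \<in> R \<Longrightarrow> x + y \<in> R"
  using subring_diff[of x "- y"] subring_uminus[of y] by simp

lemma subring_power: "x \<in> R \<Longrightarrow> x ^ n \<in> R"
  by (induction n) (auto intro: subring_one subring_mult)

lemma subring_sum: "(\<And>i. i \<in> A \<Longrightarrow> h i \<in> R) \<Longrightarrow> sum h A \<in> R"
  by (induction A rule: infinite_finite_induct) (auto intro: subring_zero subring_add)

lemma polys_over_const: "c \<in> R \<Longrightarrow> [:c:] \<in> polys_over R"
  by (auto simp: polys_over_def coeff_pCons subring_zero split: nat.splits)

lemma polys_over_monom: "c \<in> R \<Longrightarrow> monom c n \<in> polys_over R"
  by (auto simp: polys_over_def subring_zero)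

lemma is_subring_polys_over: "is_subring (polys_over R)"
  unfolding is_subring_def polys_over_def
  by (auto simp: coeff_mult coeff_1 intro!: subring_sum subring_mult subring_diff
      intro: subring_one subring_zero)

lemma polys_over_smult: "c \<in> R \<Longrightarrow> g \<in> polys_over R \<Longrightarrow> smult c g \<in> polys_over R"
  by (auto simp: polys_over_def subring_mult)

lemma polys_over_reflect: "g \<in> polys_over R \<Longrightarrow> reflect_poly g \<in> polys_over R"
  by (auto simp: polys_over_def coeff_reflect_poly subring_zero)

lemma subset_adjoin: "R \<subseteq> adjoin R z"
proof
  fix c assume "c \<in> R"
  then show "c \<in> adjoin R z"
    using polys_over_const[of c] unfolding adjoin_def by (intro image_eqI[of _ _ "[:c:]"]) auto
qed

lemma generator_in_adjoin: "z \<in> adjoin R z"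
  using polys_over_monom[OF subring_one, of 1] unfolding adjoin_def
  by (intro image_eqI[of _ _ "monom 1 1"]) (auto simp: poly_monom)

end

lemma is_subring_adjoin:
  assumes "is_subring R"
  shows "is_subring (adjoin R z)"
proof -
  note P = is_subring_polys_over[OF assms]
  have "1 \<in> adjoin R z"
    using subring_one[OF assms] subset_adjoin[OF assms] by blast
  moreover have "poly g z - poly h z \<in> adjoin R z" "poly g z * poly h z \<in> adjoin R z"
    if "g \<in> polys_over R" "h \<in> polys_over R" for g h
    using subring_diff[OF P that] subring_mult[OF P that] unfolding adjoin_def
    by (metis image_eqI poly_diff, metis image_eqI poly_mult)
  ultimately show ?thesis
    by (auto simp: is_subring_def adjoin_def)
qed

section \<open>Valuation rings from maximal subrings\<close>

definition is_valuation_ring :: "'a::field set \<Rightarrow> bool" where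
  "is_valuation_ring V \<longleftrightarrow> is_subring V \<and> (\<forall>x. x \<in> V \<or> inverse x \<in> V)"

text \<open>A subring that is maximal among those containing \<open>inverse X\<close> but not \<open>X\<close> is a valuation
  ring: otherwise \<open>X\<close> is a polynomial both in some \<open>z\<close> and in \<open>inverse z\<close>, and a relation of
  minimal total degree can be shortened, because all \<open>1 - inverse X * b\<close> are units.\<close>

lemma maximal_subring_is_valuation_ring:
  fixes X :: "'a::field"
  assumes R: "is_subring R" and YR: "inverse X \<in> R" and XR: "X \<notin> R"
    and max: "\<And>S. is_subring S \<Longrightarrow> R \<subseteq> S \<Longrightarrow> X \<notin> S \<Longrightarrow> S = R"
  shows "is_valuation_ring R"
proof -
  note sub = subring_one[OF R] subring_zero[OF R] subring_diff[OF R] subring_mult[OF R]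
    subring_add[OF R] subring_uminus[OF R] subring_power[OF R]
  note P = is_subring_polys_over[OF R]
  have X0: "X \<noteq> 0" using XR sub by auto
  have unit: "inverse (1 - inverse X * b) \<in> R" if b: "b \<in> R" for b
  proof (rule ccontr)
    define s where "s = 1 - inverse X * b"
    have sR: "s \<in> R" using b YR unfolding s_def by (intro sub)
    have s0: "s \<noteq> 0"
    proof
      assume "s = 0"
      then have "b = X" using X0 by (simp add: s_def field_simps)
      then show False using b XR by simp
    qed
    assume "inverse (1 - inverse X * b) \<notin> R"
    then have "adjoin R (inverse s) \<noteq> R"
      using generator_in_adjoin[OF R, of "inverse s"] by (auto simp: s_def)
    then have "X \<in> adjoin R (inverse s)"
      using max is_subring_adjoin[OF R] subset_adjoin[OF R] by blast
    then obtain g where g: "g \<in> polys_over R" "X = poly g (inverse s)"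
      by (auto simp: adjoin_def)
    have "s ^ degree g * X = poly (reflect_poly g) s"
      using s0 g by (simp add: poly_reflect_poly_nz)
    also have "\<dots> \<in> R"
      using polys_over_reflect[OF R g(1)] unfolding poly_altdef polys_over_def
      by (intro subring_sum[OF R] sub sR) auto
    finally have 1: "s ^ degree g * X \<in> R" .
    \<comment> \<open>\<open>s\<close> and its powers are 1 modulo \<open>inverse X\<close> times
      \<open>R\<close>, so multiplying \<open>s ^ n - 1\<close> by \<open>X\<close> stays in
      \<open>R\<close>. Together with 1 this would put \<open>X\<close> itself into
      \<open>R\<close>.\<close>
    have 2: "(s ^ n - 1) * X \<in> R" for n
    proof (induction n)
      case (Suc n)
      have "(s ^ Suc n - 1) * X = s * ((s ^ n - 1) * X) - b"
        using X0 by (simp add: s_def field_simps)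
      then show ?case using Suc sR b by (auto intro: sub)
    qed (use sub in simp)
    have "X = s ^ degree g * X - (s ^ degree g - 1) * X"
      by (simp add: algebra_simps)
    then show False using sub(3)[OF 1 2[of "degree g"]] XR by simp
  qed
  have no_relation: "False"
    if "g \<in> polys_over R" "h \<in> polys_over R" "X = poly g z" "X = poly h (inverse z)" "z \<noteq> 0"
    for g h z
    using that
  proof (induction "degree g + degree h" arbitrary: g h z rule: less_induct)
    case less
    have reduce: False
      if g: "g \<in> polys_over R" and h: "h \<in> polys_over R" and gz: "X = poly g z"
        and hz: "X = poly h (inverse z)" and z0: "z \<noteq> 0" and le: "degree h \<le> degree g"
        and IH: "\<And>g'. g' \<in> polys_over R \<Longrightarrow> X = poly g' z \<Longrightarrow> degree g' < degree g \<Longrightarrow> False"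
      for g h z
    proof -
      define n where "n = degree g"
      obtain h0 h1 where h01: "h = pCons h0 h1" by (cases h)
      have h0: "h0 \<in> R" and h1: "h1 \<in> polys_over R"
        using h by (auto simp: h01 polys_over_def coeff_pCons split: nat.splits)
      have "h1 \<noteq> 0"
        using hz h0 XR by (auto simp: h01)
      then have deg: "degree h1 < n" using le by (simp add: h01 n_def)
      define s where "s = 1 - inverse X * h0"
      define u where "u = inverse X * inverse s"
      have uR: "u \<in> R" using unit[OF h0] YR unfolding u_def s_def by (intro sub)
      have s0: "s \<noteq> 0"
        using X0 h0 XR by (auto simp: s_def field_simps)
      have "s * X = X - h0"
        using X0 by (simp add: s_def algebra_simps)
      then have sX: "s * X = inverse z * poly h1 (inverse z)"
        using hz by (simp add: h01)
      have "u * (s * X) = (inverse X * X) * (inverse s * s)"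
        unfolding u_def by (simp only: mult_ac)
      then have uX: "u * (s * X) = 1"
        using s0 X0 by simp
      \<comment> \<open>Moving the constant term of \<open>h\<close> to the other side and dividing
        by \<open>s * X\<close>, whose inverse \<open>u\<close> lies in \<open>R\<close>, turns the
        relation for \<open>inverse z\<close> into \<open>z ^ n = poly k z\<close> with
        \<open>degree k < n\<close>. This eliminates the leading term of \<open>g\<close>.\<close>
      define k where "k = smult u (monom 1 (n - 1 - degree h1) * reflect_poly h1)"
      have kR: "k \<in> polys_over R"
        unfolding k_def by (intro polys_over_smult[OF R] uR subring_mult[OF P]
          polys_over_monom[OF R] sub polys_over_reflect[OF R] h1)
      have "degree k \<le> degree (monom (1::'a) (n - 1 - degree h1)) + degree (reflect_poly h1)"
        unfolding k_def using degree_mult_le degree_smult_le le_trans by blast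
      also have "\<dots> \<le> (n - 1 - degree h1) + degree h1"
        using degree_reflect_poly_le[of h1] by (simp add: degree_monom_eq)
      finally have degk: "degree k < n" using deg by simp
      have "poly k z = u * (z ^ (n - 1 - degree h1) * (z ^ degree h1 * poly h1 (inverse z)))"
        using z0 by (simp add: k_def poly_monom poly_reflect_poly_nz)
      also have "\<dots> = u * z ^ (n - 1) * poly h1 (inverse z)"
        using deg by (simp flip: power_add mult.assoc)
      also have "\<dots> = u * z ^ n * (inverse z * poly h1 (inverse z))"
        using deg z0 by (cases n) auto
      also have "\<dots> = (u * (s * X)) * z ^ n"
        unfolding sX by (simp only: mult_ac)
      also have "\<dots> = z ^ n"
        unfolding uX by simp
      finally have kz: "poly k z = z ^ n" .
      define g' where "g' = (g - monom (coeff g n) n) + smult (coeff g n) k"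
      have gn: "coeff g n \<in> R" using g by (simp add: polys_over_def)
      have "g' \<in> polys_over R"
        unfolding g'_def
        by (intro subring_add[OF P] subring_diff[OF P] g polys_over_monom[OF R] gn
            polys_over_smult[OF R] kR)
      moreover have "X = poly g' z"
        using gz by (simp add: g'_def poly_monom kz)
      moreover have "degree g' < degree g"
      proof -
        have "degree (g - monom (coeff g n) n) < n"
          using deg by (intro degree_lessI) (auto simp: n_def coeff_eq_0)
        moreover have "degree (smult (coeff g n) k) < n"
          using degk degree_smult_le le_less_trans by blast
        ultimately show ?thesis
          unfolding g'_def n_def[symmetric] by (rule degree_add_less)
      qed
      ultimately show False by (rule IH)
    qed
    show ?case
    proof (cases "degree h \<le> degree g")
      case True
      show ?thesis
      proof (rule reduce[OF less.prems True])
        fix g' assume g': "g' \<in> polys_over R" "X = poly g' z" "degree g' < degree g"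
        then have "degree g' + degree h < degree g + degree h" by linarith
        then show False by (rule less.hyps[OF _ g'(1) less.prems(2) g'(2) less.prems(4,5)])
      qed
    next
      case False
      then have le: "degree g \<le> degree h" by linarith
      have z: "X = poly g (inverse (inverse z))" "inverse z \<noteq> 0"
        using less.prems(3,5) by simp_all
      show ?thesis
      proof (rule reduce[OF less.prems(2,1,4) z le])
        fix h' assume h': "h' \<in> polys_over R" "X = poly h' (inverse z)" "degree h' < degree h"
        then have "degree g + degree h' < degree g + degree h" by linarith
        then show False
          by (rule less.hyps[OF _ less.prems(1) h'(1) less.prems(3) h'(2) less.prems(5)])
      qed
    qed
  qed
  have "z \<in> R \<or> inverse z \<in> R" for z
  proof (rule ccontr)
    assume *: "\<not> (z \<in> R \<or> inverse z \<in> R)"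
    have "X \<in> adjoin R y" if "y \<notin> R" for y
      using max[OF is_subring_adjoin[OF R] subset_adjoin[OF R]] generator_in_adjoin[OF R] that
      by metis
    then have "X \<in> adjoin R z" "X \<in> adjoin R (inverse z)"
      using * by auto
    then obtain g h where "g \<in> polys_over R" "h \<in> polys_over R" "X = poly g z"
      "X = poly h (inverse z)"
      unfolding adjoin_def by blast
    moreover have "z \<noteq> 0" using * sub(2) by blast
    ultimately show False by (rule no_relation)
  qed
  then show ?thesis using R by (auto simp: is_valuation_ring_def)
qed

lemma is_subring_range_of_int: "is_subring (range (of_int :: int \<Rightarrow> 'a::comm_ring_1))"
  unfolding is_subring_def by (auto simp flip: of_int_diff of_int_mult intro: range_eqI[of _ _ 1])

text \<open>If \<open>X\<close> lay in the ring generated by \<open>inverse X\<close>, clearing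
  denominators would give a monic equation for \<open>X\<close>. Otherwise Zorn's lemma enlarges
  that ring to one maximal without \<open>X\<close>, which is a valuation ring missing
  \<open>X\<close>.\<close>

theorem Fp_bar_if_in_all_valuation_rings:
  fixes X :: "'a::field"
  assumes "\<And>V. is_valuation_ring V \<Longrightarrow> X \<in> V"
  shows "X \<in> Fp_bar"
proof (rule ccontr)
  assume nFp: "X \<notin> Fp_bar"
  let ?Z = "range (of_int :: int \<Rightarrow> 'a)"
  note Z = is_subring_range_of_int[where 'a = 'a]
  have X0: "X \<noteq> 0"
  proof
    assume "X = 0"
    moreover have "algebraic_over ?Z 0"
      unfolding algebraic_over_def using polys_over_monom[OF Z subring_one[OF Z], of 1]
      by (intro exI[of _ "monom 1 1"]) (auto simp: poly_monom polys_over_def)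
    ultimately show False using nFp by (simp add: Fp_bar_def)
  qed
  define \<A> where "\<A> = {R. is_subring R \<and> inverse X \<in> R \<and> X \<notin> R}"
  have "X \<notin> adjoin ?Z (inverse X)"
  proof
    assume "X \<in> adjoin ?Z (inverse X)"
    then obtain g where g: "g \<in> polys_over ?Z" "X = poly g (inverse X)"
      by (auto simp: adjoin_def)
    define h where "h = monom 1 (Suc (degree g)) - reflect_poly g"
    have "coeff h (Suc (degree g)) = 1"
      using degree_reflect_poly_le[of g] by (simp add: h_def coeff_eq_0)
    then have "h \<noteq> 0" by auto
    moreover have "h \<in> polys_over ?Z"
      unfolding h_def
      by (intro subring_diff[OF is_subring_polys_over[OF Z]] polys_over_monom[OF Z]
          subring_one[OF Z] polys_over_reflect[OF Z] g)
    moreover have "poly h X = 0"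
      using X0 g(2) by (simp add: h_def poly_monom poly_reflect_poly_nz)
    ultimately show False
      using nFp by (auto simp: Fp_bar_def algebraic_over_def polys_over_def)
  qed
  then have "adjoin ?Z (inverse X) \<in> \<A>"
    using is_subring_adjoin[OF Z] generator_in_adjoin[OF Z] by (auto simp: \<A>_def)
  moreover have "\<Union> C \<in> \<A>" if C: "C \<noteq> {}" "subset.chain \<A> C" for C
  proof -
    have C\<A>: "C \<subseteq> \<A>" and tot: "\<And>A B. A \<in> C \<Longrightarrow> B \<in> C \<Longrightarrow> A \<subseteq> B \<or> B \<subseteq> A"
      using C(2) by (auto simp: subset.chain_def)
    have "x - y \<in> \<Union> C \<and> x * y \<in> \<Union> C" if xy: "x \<in> \<Union> C" "y \<in> \<Union> C" for x y
    proof -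
      obtain A B where AB: "A \<in> C" "x \<in> A" "B \<in> C" "y \<in> B" using xy by blast
      obtain D where D: "D \<in> C" "x \<in> D" "y \<in> D" using tot[OF AB(1,3)] AB by auto
      then have "is_subring D" using C\<A> by (auto simp: \<A>_def)
      then show ?thesis using D by (auto simp: is_subring_def)
    qed
    moreover have "1 \<in> \<Union> C" "inverse X \<in> \<Union> C" "X \<notin> \<Union> C"
      using C(1) C\<A> by (auto simp: \<A>_def is_subring_def)
    ultimately show ?thesis by (auto simp: \<A>_def is_subring_def)
  qed
  ultimately obtain R where R: "R \<in> \<A>" "\<And>S. S \<in> \<A> \<Longrightarrow> R \<subseteq> S \<Longrightarrow> S = R"
    using subset_Zorn_nonempty[of \<A>] by blast
  have "is_valuation_ring R"
    using R by (intro maximal_subring_is_valuation_ring[of R X]) (auto simp: \<A>_def)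
  then show False using assms R by (auto simp: \<A>_def)
qed

section \<open>The algebraic closure of the prime field\<close>

lemma of_int_power_CHAR:
  assumes "prime CHAR('a::comm_ring_1)"
  shows "(of_int a :: 'a) ^ CHAR('a) = of_int a"
proof -
  have nat: "(of_nat n :: 'a) ^ CHAR('a) = of_nat n" for n
  proof (induction n)
    case 0
    then show ?case using prime_gt_0_nat[OF assms] by (simp add: power_0_left)
  next
    case (Suc n)
    then show ?case using freshmans_dream[OF assms refl, of 1 "of_nat n"] by simp
  qed
  show ?thesis
    using minus_power_prime_CHAR[OF refl assms]
    by (cases a rule: int_cases2) (simp_all add: nat)
qed

lemma power_CHAR_power_diff:
  assumes "prime CHAR('a::comm_ring_1)"
  shows "(x - y :: 'a) ^ (CHAR('a) ^ n) = x ^ (CHAR('a) ^ n) - y ^ (CHAR('a) ^ n)"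
  using freshmans_dream'[OF assms refl, of "x - y" y n] by simp

lemma power_fixed_iterate:
  fixes x :: "'a::monoid_mult"
  assumes "x ^ (p ^ n) = x"
  shows "x ^ (p ^ (n * k)) = x"
proof (induction k)
  case (Suc k)
  have "x ^ (p ^ (n * Suc k)) = (x ^ (p ^ n)) ^ (p ^ (n * k))"
    by (simp add: power_add power_mult)
  then show ?case using assms Suc by simp
qed auto

text \<open>Frobenius maps the finite root set of a polynomial over the prime field to itself, so
  two of its iterates agree at \<open>x\<close>, and injectivity cancels the smaller one.\<close>

lemma Fp_bar_iff:
  fixes x :: "'a::field"
  assumes p: "prime CHAR('a)"
  shows "x \<in> Fp_bar \<longleftrightarrow> (\<exists>n>0. x ^ (CHAR('a) ^ n) = x)"
proof
  let ?p = "CHAR('a)"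
  assume "x \<in> Fp_bar"
  then obtain g :: "'a poly" where g: "g \<noteq> 0" "\<And>i. coeff g i \<in> range of_int" "poly g x = 0"
    by (auto simp: Fp_bar_def algebraic_over_def)
  have frob: "poly g (y ^ ?p) = poly g y ^ ?p" for y
  proof -
    have "coeff g i ^ ?p = coeff g i" for i
      using g(2)[of i] of_int_power_CHAR[OF p] by auto
    then show ?thesis
      by (simp add: poly_altdef freshmans_dream_sum[OF p refl] power_mult_distrib
          flip: power_mult) (simp add: mult.commute)
  qed
  have "poly g (x ^ (?p ^ n)) = 0" for n
  proof (induction n)
    case (Suc n)
    have "x ^ (?p ^ Suc n) = (x ^ (?p ^ n)) ^ ?p"
      by (simp add: mult.commute flip: power_mult)
    then show ?case using Suc frob[of "x ^ (?p ^ n)"] prime_gt_0_nat[OF p]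
      by (simp add: power_0_left)
  qed (use g in simp)
  then have "finite (range (\<lambda>n. x ^ (?p ^ n)))"
    by (intro finite_subset[OF _ poly_roots_finite[OF g(1)]]) auto
  then have "\<not> inj (\<lambda>n. x ^ (?p ^ n))"
    using finite_imageD infinite_UNIV_nat by blast
  then obtain i j where ij: "x ^ (?p ^ i) = x ^ (?p ^ j)" "i < j"
    by (metis (no_types, lifting) injI linorder_neqE_nat)
  define n where "n = j - i"
  have "(x ^ (?p ^ n) - x) ^ (?p ^ i) = x ^ (?p ^ (n + i)) - x ^ (?p ^ i)"
    by (simp add: power_CHAR_power_diff[OF p] power_add power_mult)
  also have "\<dots> = 0" using ij by (simp add: n_def)
  finally have "x ^ (?p ^ n) = x" by simp
  then show "\<exists>n>0. x ^ (?p ^ n) = x" using ij n_def by (intro exI[of _ n]) auto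
next
  let ?p = "CHAR('a)"
  assume "\<exists>n>0. x ^ (?p ^ n) = x"
  then obtain n where n: "n > 0" "x ^ (?p ^ n) = x" by auto
  define g :: "'a poly" where "g = monom 1 (?p ^ n) - monom 1 1"
  have "?p ^ n > 1" using n prime_gt_1_nat[OF p] by (metis one_less_power)
  then have "coeff g (?p ^ n) = 1" by (simp add: g_def)
  then have "g \<noteq> 0" by auto
  moreover have "g \<in> polys_over (range of_int)"
    unfolding g_def
    by (intro subring_diff[OF is_subring_polys_over] polys_over_monom is_subring_range_of_int
        subring_one)
  moreover have "poly g x = 0" using n by (simp add: g_def poly_monom)
  ultimately show "x \<in> Fp_bar"
    by (auto simp: Fp_bar_def algebraic_over_def polys_over_def)
qed

lemma Fp_bar_root_of_unity:
  fixes x :: "'a::field"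
  assumes p: "prime CHAR('a)" and "x \<in> Fp_bar" "x \<noteq> 0"
  shows "\<exists>m>0. x ^ m = 1"
proof -
  obtain n where n: "n > 0" "x ^ (CHAR('a) ^ n) = x"
    using assms Fp_bar_iff[OF p] by auto
  have "CHAR('a) ^ n > 1" using n prime_gt_1_nat[OF p] by (metis one_less_power)
  moreover from this have "x ^ (CHAR('a) ^ n - 1) * x = x"
    using n power_minus_mult[of "CHAR('a) ^ n" x] prime_gt_0_nat[OF p] by simp
  ultimately show ?thesis using assms by (intro exI[of _ "CHAR('a) ^ n - 1"]) auto
qed

lemma of_int_in_Fp_bar: "of_int a \<in> (Fp_bar :: 'a::field set)"
proof -
  let ?g = "[:- of_int a, 1:] :: 'a poly"
  have "?g \<in> polys_over (range of_int)"
    by (auto simp: polys_over_def coeff_pCons split: nat.splits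
        simp flip: of_int_minus intro: range_eqI[of _ _ 0] range_eqI[of _ _ 1])
  then show ?thesis
    by (auto simp: Fp_bar_def algebraic_over_def polys_over_def intro!: exI[of _ ?g])
qed

text \<open>Different primes need different witnesses. This serves both for roots of unity of prime
  order and for parameters with a prescribed prime period.\<close>

lemma infinite_prime_family:
  assumes "\<And>n. prime n \<Longrightarrow> n > (m::nat) \<Longrightarrow> \<exists>x\<in>S. P n x"
    and "\<And>n n' x. prime n \<Longrightarrow> prime n' \<Longrightarrow> P n x \<Longrightarrow> P n' x \<Longrightarrow> n = n'"
  shows "infinite S"
proof
  assume fin: "finite S"
  define N where "N = {n. prime n \<and> n > m}"
  obtain \<phi> where \<phi>: "\<And>n. n \<in> N \<Longrightarrow> \<phi> n \<in> S \<and> P n (\<phi> n)"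
    using assms(1) unfolding N_def by (metis (mono_tags, lifting) mem_Collect_eq)
  have "inj_on \<phi> N"
    using \<phi> assms(2) by (intro inj_onI) (metis (mono_tags, lifting) N_def mem_Collect_eq)
  moreover have "finite (\<phi> ` N)" using \<phi> by (intro finite_subset[OF _ fin]) auto
  ultimately have "finite N" using finite_imageD by blast
  then have "finite (N \<union> {..m})" by simp
  moreover have "{n. prime n} \<subseteq> N \<union> {..m}" by (auto simp: N_def)
  ultimately show False using primes_infinite finite_subset by blast
qed

lemma power_eq_1_coprime:
  fixes x :: "'a::field"
  assumes "coprime m n" "x ^ m = 1" "x ^ n = 1" "m > 0"
  shows "x = 1"
proof -
  obtain a b where "m * a = n * b + 1"
    using assms bezout_nat[of m n] by (metis coprime_imp_gcd_eq_1 not_gr_zero)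
  then have "x ^ (m * a) = x ^ (n * b) * x" by simp
  then show ?thesis using assms by (simp add: power_mult)
qed

lemma infinite_Fp_bar:
  assumes p: "prime CHAR('a::alg_closed_field)"
  shows "infinite (Fp_bar :: 'a set)"
proof (rule infinite_prime_family[where m = "CHAR('a)" and P = "\<lambda>n x. x ^ n = 1 \<and> x \<noteq> 1"])
  fix n assume n: "prime n" "n > CHAR('a)"
  \<comment> \<open>A root of this polynomial is an \<open>n\<close>-th root of unity. It is not 1,
    because the value at 1 is \<open>n\<close>, which is nonzero in the field for a prime
    \<open>n\<close> above the characteristic.\<close>
  define g :: "'a poly" where "g = (\<Sum>k<n. monom 1 k)"
  have "coeff g (n - 1) = 1"
    using n by (simp add: g_def coeff_sum)
  moreover have "n \<ge> 2" using n prime_ge_2_nat by auto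
  ultimately have "degree g \<ge> n - 1" by (intro le_degree) auto
  then have "degree g > 0" using \<open>n \<ge> 2\<close> by simp
  then obtain x where x: "poly g x = 0" using alg_closed_imp_poly_has_root by blast
  then have sum: "(\<Sum>k<n. x ^ k) = 0" by (simp add: g_def poly_sum poly_monom)
  have "x ^ n = 1" using sum power_diff_1_eq[of x n] by simp
  moreover have "x \<noteq> 1"
  proof
    assume "x = 1"
    then have "of_nat n = (0::'a)" using sum by simp
    then have "CHAR('a) dvd n" by (simp add: of_nat_eq_0_iff_char_dvd)
    then show False using n p by (metis less_irrefl prime_nat_iff not_prime_1)
  qed
  moreover have "x \<in> Fp_bar"
  proof -
    let ?h = "monom 1 n - 1 :: 'a poly"
    have "coeff ?h n = 1" using n by (auto simp: coeff_1 prime_gt_0_nat)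
    then have "?h \<noteq> 0" by (metis coeff_0 zero_neq_one)
    moreover have "?h \<in> polys_over (range of_int)"
      by (intro subring_diff[OF is_subring_polys_over] polys_over_monom is_subring_range_of_int
          subring_one is_subring_polys_over)
    moreover have "poly ?h x = 0" using \<open>x ^ n = 1\<close> by (simp add: poly_monom)
    ultimately show ?thesis
      by (auto simp: Fp_bar_def algebraic_over_def polys_over_def intro!: exI[of _ ?h])
  qed
  ultimately show "\<exists>x\<in>(Fp_bar :: 'a set). x ^ n = 1 \<and> x \<noteq> 1" by blast
next
  fix n n' :: nat and x :: 'a
  assume "prime n" "prime n'" "x ^ n = 1 \<and> x \<noteq> 1" "x ^ n' = 1 \<and> x \<noteq> 1"
  then show "n = n'"
    using power_eq_1_coprime[of n n' x] primes_coprime_nat prime_gt_0_nat by blast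
qed

section \<open>The preorder of a valuation ring\<close>

text \<open>\<open>le x y\<close> and \<open>lt x y\<close> stand for \<open>|x| \<le> |y|\<close> and \<open>|x| < |y|\<close>. The rank of the valuation is
  arbitrary, so that inequalities with rational exponents are stated with powers.\<close>

locale valuation_ring =
  fixes V :: "'a::field set"
  assumes valuation_ring: "is_valuation_ring V"
begin

text \<open>As membership in the fractional ideal \<open>V y\<close>, the comparison needs neither a
  value group nor a separate case for zero.\<close>

definition le :: "'a \<Rightarrow> 'a \<Rightarrow> bool" where "le x y \<longleftrightarrow> (\<exists>z\<in>V. x = z * y)"
definition lt :: "'a \<Rightarrow> 'a \<Rightarrow> bool" where "lt x y \<longleftrightarrow> \<not> le y x"

lemma subring: "is_subring V"
  using valuation_ring by (simp add: is_valuation_ring_def)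

lemma in_iff_le_1: "x \<in> V \<longleftrightarrow> le x 1"
  by (auto simp: le_def)

lemma le_refl [simp]: "le x x"
  using subring_one[OF subring] by (auto simp: le_def intro: bexI[of _ 1])

lemma zero_le [simp]: "le 0 x"
  using subring_zero[OF subring] by (auto simp: le_def intro: bexI[of _ 0])

lemma le_trans [trans]: "le x y \<Longrightarrow> le y z \<Longrightarrow> le x z"
  using subring_mult[OF subring] by (auto simp: le_def simp flip: mult.assoc)

lemma le_total: "le x y \<or> le y x"
proof (cases "x = 0 \<or> y = 0")
  case False
  then have "x / y \<in> V \<or> y / x \<in> V"
    using valuation_ring unfolding is_valuation_ring_def by (metis inverse_divide)
  then show ?thesis
    using False unfolding le_def by (metis nonzero_divide_eq_eq)
qed auto

lemma lt_imp_le: "lt x y \<Longrightarrow> le x y"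
  using le_total by (auto simp: lt_def)

lemma not_lt: "\<not> lt x y \<longleftrightarrow> le y x"
  by (simp add: lt_def)

lemma lt_le_trans [trans]: "lt x y \<Longrightarrow> le y z \<Longrightarrow> lt x z"
  and le_lt_trans [trans]: "le x y \<Longrightarrow> lt y z \<Longrightarrow> lt x z"
  unfolding lt_def using le_trans by blast+

lemma lt_trans [trans]: "lt x y \<Longrightarrow> lt y z \<Longrightarrow> lt x z"
  using lt_imp_le lt_le_trans by blast

lemma lt_irrefl [simp]: "\<not> lt x x"
  by (simp add: lt_def)

lemma lt_nonzero: "lt x y \<Longrightarrow> y \<noteq> 0"
  by (auto simp: lt_def)

lemma le_add: "le x z \<Longrightarrow> le y z \<Longrightarrow> le (x + y) z"
  using subring_add[OF subring] by (auto simp: le_def simp flip: distrib_right)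

lemma le_minus_self: "le (- x) x"
  unfolding le_def using subring_uminus[OF subring subring_one[OF subring]]
  by (intro bexI[of _ "- 1"]) auto

lemma le_minus_left [simp]: "le (- x) y \<longleftrightarrow> le x y"
  using le_minus_self[of x] le_minus_self[of "- x"] le_trans[of "- x" x y] le_trans[of x "- x" y]
  by auto

lemma le_minus_right [simp]: "le x (- y) \<longleftrightarrow> le x y"
  using le_minus_self[of y] le_minus_self[of "- y"] le_trans[of x y "- y"] le_trans[of x "- y" y]
  by auto

lemma lt_minus_left [simp]: "lt (- x) y \<longleftrightarrow> lt x y"
  by (simp add: lt_def)

lemma le_diff: "le x z \<Longrightarrow> le y z \<Longrightarrow> le (x - y) z"
  using le_add[of x z "- y"] by simp

lemma lt_add: "lt x z \<Longrightarrow> lt y z \<Longrightarrow> lt (x + y) z"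
  using le_total[of x y] le_add[of x x y] le_add[of x y y] le_lt_trans le_refl by blast

lemma lt_diff: "lt x z \<Longrightarrow> lt y z \<Longrightarrow> lt (x - y) z"
  using lt_add[of x z "- y"] by simp

lemma le_add_dominant: "lt x y \<Longrightarrow> le y (x + y)"
  using lt_diff[of "x + y" y x] not_lt[of "x + y" y] by auto

lemma le_mult: "le x y \<Longrightarrow> le x' y' \<Longrightarrow> le (x * x') (y * y')"
proof -
  assume "le x y" "le x' y'"
  then obtain z z' where "z \<in> V" "x = z * y" "z' \<in> V" "x' = z' * y'"
    unfolding le_def by blast
  then show ?thesis
    using subring_mult[OF subring, of z z'] unfolding le_def by (intro bexI[of _ "z * z'"]) auto
qed

lemma le_mult_cancel: "z \<noteq> 0 \<Longrightarrow> le (x * z) (y * z) \<longleftrightarrow> le x y"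
  by (auto simp: le_def)

lemma lt_mult_cancel: "z \<noteq> 0 \<Longrightarrow> lt (x * z) (y * z) \<longleftrightarrow> lt x y"
  by (simp add: lt_def le_mult_cancel)

lemma lt_mult_left: "lt x y \<Longrightarrow> le x' y' \<Longrightarrow> y' \<noteq> 0 \<Longrightarrow> lt (x * x') (y * y')"
  using le_lt_trans[OF le_mult[OF le_refl], of x' y' x "y * y'"] lt_mult_cancel[of y' x y] by blast

lemma lt_mult_right: "le x y \<Longrightarrow> lt x' y' \<Longrightarrow> y \<noteq> 0 \<Longrightarrow> lt (x * x') (y * y')"
  using lt_mult_left[of x' y' x y] by (simp add: mult.commute)

lemma le_power: "le x y \<Longrightarrow> le (x ^ n) (y ^ n)"
  by (induction n) (auto intro: le_mult)

lemma lt_power: "lt x y \<Longrightarrow> n > 0 \<Longrightarrow> lt (x ^ n) (y ^ n)"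
proof (induction n)
  case (Suc n)
  then show ?case
    using lt_nonzero[of x y]
      lt_mult_left[OF Suc.prems(1) le_power[OF lt_imp_le[OF Suc.prems(1)], of n]]
    by simp
qed auto

lemma le_power_iff: "n > 0 \<Longrightarrow> le (x ^ n) (y ^ n) \<longleftrightarrow> le x y"
  using le_power[of x y n] lt_power[of y x n] by (auto simp: lt_def)

lemma one_lt_power: "lt 1 x \<Longrightarrow> n > 0 \<Longrightarrow> lt 1 (x ^ n)"
  using lt_power[of 1 x n] by simp

lemma one_le_power: "le 1 x \<Longrightarrow> le 1 (x ^ n)"
  using le_power[of 1 x n] by simp

lemma lt_power_exponent: "lt 1 x \<Longrightarrow> m < n \<Longrightarrow> lt (x ^ m) (x ^ n)"
  using one_lt_power[of x "n - m"] lt_mult_cancel[of "x ^ m" 1 "x ^ (n - m)"] lt_nonzero[of 1 x]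
  by (simp flip: power_add)

lemma le_power_exponent: "le 1 x \<Longrightarrow> m \<le> n \<Longrightarrow> le (x ^ m) (x ^ n)"
  using one_le_power[of x "n - m"] le_mult[of 1 "x ^ (n - m)" "x ^ m" "x ^ m"]
  by (simp flip: power_add)

lemma le_power_exponent_iff: "lt 1 x \<Longrightarrow> le (x ^ m) (x ^ n) \<longleftrightarrow> m \<le> n"
  using lt_power_exponent[of x n m] le_power_exponent[of x m n] lt_imp_le[of 1 x]
  by (auto simp: lt_def not_le[symmetric])

text \<open>The ultrametric inequality for bounds by \<open>n\<close>-th roots, which need not exist
  in the value group: the larger of \<open>x\<close> and \<open>y\<close> bounds the sum.\<close>

lemma power_add_le: "le (x ^ n) z \<Longrightarrow> le (y ^ n) z \<Longrightarrow> le ((x + y) ^ n) z"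
  using le_total[of x y] le_add[of x x y] le_add[of x y y] le_power[of "x + y" _ n] le_trans le_refl
  by blast

lemma power_diff_le: "le (x ^ n) z \<Longrightarrow> le (y ^ n) z \<Longrightarrow> le ((x - y) ^ n) z"
  using power_add_le[of x n z "- y"] le_trans[OF le_power[of "- y" y n], of z] by simp

lemma power_diff_lt: "lt (x ^ n) z \<Longrightarrow> lt (y ^ n) z \<Longrightarrow> lt ((x - y) ^ n) z"
  using le_total[of x y] le_diff[of x x y] le_diff[of x y y] le_power[of "x - y" _ n] le_lt_trans
    le_refl by blast

lemma lt_sequence_infinite:
  assumes "\<And>n. lt (s n) (s (Suc n))"
  shows "infinite (range s)"
proof -
  have "lt (s m) (s (Suc (m + k)))" for m k
    by (induction k) (auto intro: assms lt_trans)
  then have "lt (s m) (s n)" if "m < n" for m n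
    using less_imp_Suc_add[OF that] by auto
  then have "inj s"
    by (intro injI) (metis linorder_neqE_nat lt_irrefl)
  then show ?thesis using finite_imageD infinite_UNIV_nat by blast
qed

lemma Fp_bar_unit:
  assumes "prime CHAR('a)" "u \<in> Fp_bar" "u \<noteq> 0"
  shows "le u 1" "le 1 u"
proof -
  obtain m where "m > 0" "u ^ m = 1" using Fp_bar_root_of_unity assms by blast
  then show "le u 1" "le 1 u"
    using le_power_iff[of m u 1] le_power_iff[of m 1 u] by simp_all
qed

lemma le_unit_mult: "le u 1 \<Longrightarrow> le 1 u \<Longrightarrow> le (u * x) y \<longleftrightarrow> le x y"
  using le_mult[of u 1 x x] le_mult[of 1 u x x] le_trans[of x "u * x" y] le_trans[of "u * x" x y]
  by auto

lemma le_mult_unit: "le u 1 \<Longrightarrow> le 1 u \<Longrightarrow> le x (u * y) \<longleftrightarrow> le x y"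
  using le_mult[of u 1 y y] le_mult[of 1 u y y] le_trans[of x "u * y" y] le_trans[of x y "u * y"]
  by auto

lemma lt_unit_mult: "le u 1 \<Longrightarrow> le 1 u \<Longrightarrow> lt (u * x) y \<longleftrightarrow> lt x y"
  and lt_mult_unit: "le u 1 \<Longrightarrow> le 1 u \<Longrightarrow> lt x (u * y) \<longleftrightarrow> lt x y"
  by (simp_all add: lt_def le_unit_mult le_mult_unit)

end

section \<open>Parameters for which a given point is preperiodic\<close>

lemma preperiodic_step: "preperiodic g (g x) \<longleftrightarrow> preperiodic g x"
proof -
  have "range (\<lambda>n. (g ^^ n) x) = insert x (range (\<lambda>n. (g ^^ n) (g x)))"
  proof (intro equalityI subsetI)
    fix y assume "y \<in> range (\<lambda>n. (g ^^ n) x)"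
    then obtain n where "y = (g ^^ n) x" by auto
    then show "y \<in> insert x (range (\<lambda>n. (g ^^ n) (g x)))"
      by (cases n) (auto simp: funpow_Suc_right simp del: funpow.simps)
  next
    fix y assume "y \<in> insert x (range (\<lambda>n. (g ^^ n) (g x)))"
    then consider "y = (g ^^ 0) x" | n where "y = (g ^^ Suc n) x"
      by (auto simp: funpow_Suc_right simp del: funpow.simps(2))
    then show "y \<in> range (\<lambda>n. (g ^^ n) x)" by cases blast+
  qed
  then show ?thesis by (simp add: preperiodic_def)
qed

lemma preperiodic_if_invariant:
  assumes "finite K" "\<And>y. y \<in> K \<Longrightarrow> g y \<in> K" "x \<in> K"
  shows "preperiodic g x"
proof -
  have "(g ^^ n) x \<in> K" for n by (induction n) (use assms in auto)
  then show ?thesis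
    unfolding preperiodic_def by (intro finite_subset[OF _ assms(1)]) auto
qed

text \<open>All data are fixed by one common power of Frobenius. Its fixed points form a finite set
  that the map preserves.\<close>

lemma preperiodic_Fp_bar:
  fixes c1 c2 x c :: "'a::field"
  assumes p: "prime CHAR('a)" and "c1 \<in> Fp_bar" "c2 \<in> Fp_bar" "x \<in> Fp_bar" "c \<in> Fp_bar"
  shows "preperiodic (\<lambda>x. poly (monom c1 d1 + monom c2 d2) x + c) x"
proof -
  obtain n1 n2 n3 n4 where n: "n1 > 0" "c1 ^ (CHAR('a) ^ n1) = c1" "n2 > 0"
    "c2 ^ (CHAR('a) ^ n2) = c2" "n3 > 0" "x ^ (CHAR('a) ^ n3) = x"
    "n4 > 0" "c ^ (CHAR('a) ^ n4) = c"
    using assms(2-)[unfolded Fp_bar_iff[OF p]] by blast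
  define N where "N = n1 * n2 * n3 * n4"
  define q where "q = CHAR('a) ^ N"
  have fixed: "c1 ^ q = c1" "c2 ^ q = c2" "x ^ q = x" "c ^ q = c"
    using power_fixed_iterate[OF n(2), of "n2 * n3 * n4"]
      power_fixed_iterate[OF n(4), of "n1 * n3 * n4"]
      power_fixed_iterate[OF n(6), of "n1 * n2 * n4"]
      power_fixed_iterate[OF n(8), of "n1 * n2 * n3"]
    unfolding q_def N_def by (simp_all only: mult_ac)
  define K where "K = {y :: 'a. y ^ q = y}"
  have q1: "q > 1"
    unfolding q_def using n prime_gt_1_nat[OF p] by (intro one_less_power) (auto simp: N_def)
  have "coeff (monom 1 q - monom 1 1 :: 'a poly) q = 1" using q1 by simp
  then have "monom 1 q - monom 1 1 \<noteq> (0 :: 'a poly)" by (metis coeff_0 zero_neq_one)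
  from poly_roots_finite[OF this] have "finite K" by (simp add: K_def poly_monom)
  moreover have "poly (monom c1 d1 + monom c2 d2) y + c \<in> K" if "y \<in> K" for y
  proof -
    have "(y ^ d) ^ q = (y ^ q) ^ d" for d
      unfolding power_mult[symmetric] by (simp only: mult.commute)
    then have "(y ^ d) ^ q = y ^ d" for d
      using that by (simp add: K_def)
    then show ?thesis
      by (simp add: K_def poly_monom freshmans_dream'[OF p q_def] power_mult_distrib fixed)
  qed
  moreover have "x \<in> K" by (simp add: K_def fixed)
  ultimately show ?thesis by (rule preperiodic_if_invariant)
qed

section \<open>Parameters with a prescribed prime period\<close>

lemma periodic_coprime_fixed:
  assumes "coprime m n" "m > 0" "(g ^^ m) x = x" "(g ^^ n) x = x"
  shows "g x = x"
proof -
  have iter: "(g ^^ (k * j)) x = x" if "(g ^^ k) x = x" for k j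
    using that by (induction j) (auto simp: funpow_add)
  obtain a b where "m * a = n * b + 1"
    using bezout_nat[of m n] assms by (metis coprime_imp_gcd_eq_1 not_gr_zero)
  then have "(g ^^ (m * a)) x = g ((g ^^ (n * b)) x)" by simp
  then show ?thesis using iter assms by simp
qed

text \<open>The indeterminate is the parameter \<open>c\<close>, so that periodicity of \<alpha>
  becomes a root condition on \<open>c\<close>.\<close>

primrec orbit_poly :: "'a::comm_ring_1 poly \<Rightarrow> 'a \<Rightarrow> nat \<Rightarrow> 'a poly" where
  "orbit_poly f \<alpha> 0 = [:\<alpha>:]"
| "orbit_poly f \<alpha> (Suc n) = pcompose f (orbit_poly f \<alpha> n) + [:0, 1:]"

lemma poly_orbit_poly: "poly (orbit_poly f \<alpha> n) c = ((\<lambda>x. poly f x + c) ^^ n) \<alpha>"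
  by (induction n) (simp_all add: poly_pcompose)

text \<open>The first iterate \<open>f(\<alpha>) + c\<close> has degree 1. Each further step
  multiplies the degree by \<open>degree f\<close>, and the added \<open>c\<close> cannot interfere
  because that product exceeds 1.\<close>

lemma degree_orbit_poly:
  fixes f :: "'a::idom poly"
  assumes "degree f > 1"
  shows "degree (orbit_poly f \<alpha> (Suc n)) = degree f ^ n"
proof (induction n)
  case 0
  have "degree (pcompose f [:\<alpha>:]) = 0" by (simp add: degree_pcompose)
  then show ?case by (simp add: degree_add_eq_right)
next
  case (Suc n)
  have "degree f ^ Suc n > 1" using assms by (intro one_less_power) auto
  then show ?case
    using Suc by (subst orbit_poly.simps(2), subst degree_add_eq_left) (auto simp: degree_pcompose)
qed

lemma poly_single_root_eq_power:
  fixes g :: "'a::alg_closed_field poly"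
  assumes "g \<noteq> 0" "\<And>x. poly g x = 0 \<Longrightarrow> x = a"
  shows "g = smult (lead_coeff g) ([:- a, 1:] ^ degree g)"
proof -
  obtain A where A: "size A = degree g" "g = smult (lead_coeff g) (\<Prod>x\<in>#A. [:- x, 1:])"
    using alg_closed_imp_factorization[OF assms(1)] by blast
  have "x = a" if "x \<in># A" for x
  proof (rule assms(2))
    have "poly (\<Prod>x\<in>#A. [:- x, 1:]) x = 0"
      using that by (auto simp: poly_prod_mset prod_mset_zero_iff)
    then show "poly g x = 0" by (subst A(2)) simp
  qed
  then have "A = replicate_mset (size A) a"
    by (intro set_mset_subset_singletonD) auto
  then show ?thesis using A by (metis image_replicate_mset prod_mset_replicate_mset)
qed

text \<open>For every prime \<open>n\<close> some \<open>c\<close> gives \<open>\<alpha>\<close> the exact period \<open>n\<close>: otherwise \<open>\<alpha> - f(\<alpha>)\<close> would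
  be the only root of the polynomial \<open>f\<^sub>c\<^sup>n(\<alpha>) - \<alpha>\<close> in \<open>c\<close>, which would then be a \<open>p\<close>-th power up to
  a constant; but its derivative is \<open>1\<close> modulo \<open>f\<^sub>c\<^sup>n\<^sup>-\<^sup>1(\<alpha>)\<close>.\<close>

lemma infinite_preperiodic_parameters:
  fixes f :: "'a::alg_closed_field poly" and \<alpha> :: 'a
  assumes "[:0, 1:] ^ 2 dvd f" "CHAR('a) dvd degree f" "degree f > 1"
  shows "infinite {c. preperiodic (\<lambda>x. poly f x + c) \<alpha>}"
proof (rule infinite_prime_family[where m = 0
      and P = "\<lambda>n c. ((\<lambda>x. poly f x + c) ^^ n) \<alpha> = \<alpha> \<and> poly f \<alpha> + c \<noteq> \<alpha>"])
  fix n :: nat assume "prime n"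
  then obtain m where n: "n = Suc (Suc m)"
    using prime_ge_2_nat[of n] le_Suc_ex[of 2 n] by auto
  define P where "P = orbit_poly f \<alpha> (Suc m)"
  define T where "T = orbit_poly f \<alpha> n - [:\<alpha>:]"
  obtain h where h: "f = [:0, 1:] ^ 2 * h" using assms(1) by (elim dvdE)
  have degP: "degree P > 0"
    using degree_orbit_poly[OF assms(3), of \<alpha> m] assms(3) by (simp add: P_def)
  have degT: "degree T = degree f ^ Suc m"
  proof -
    have "degree f ^ Suc m > 0" using assms(3) by simp
    then have "degree [:\<alpha>:] < degree (orbit_poly f \<alpha> n)"
      using degree_orbit_poly[OF assms(3), of \<alpha> "Suc m"] unfolding n by simp
    then have "degree T = degree (orbit_poly f \<alpha> n)"
      unfolding T_def diff_conv_add_uminus by (intro degree_add_eq_left) simp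
    then show ?thesis unfolding n degree_orbit_poly[OF assms(3)] .
  qed
  have T: "T = P\<^sup>2 * pcompose h P + [:- \<alpha>, 1:]"
  proof -
    have "pcompose [:0, 1:] P = P" by (simp add: pcompose_pCons)
    then have "pcompose f P = P\<^sup>2 * pcompose h P"
      by (simp only: h pcompose_mult power2_eq_square)
    moreover have "T = pcompose f P + [:0, 1:] - [:\<alpha>:]"
      unfolding T_def n P_def by (simp only: orbit_poly.simps(2))
    ultimately show ?thesis by simp
  qed
  \<comment> \<open>The excluded value is the parameter that makes \<alpha> a fixed point.\<close>
  have "\<exists>c. poly T c = 0 \<and> c \<noteq> \<alpha> - poly f \<alpha>"
  proof (rule ccontr)
    assume "\<not> ?thesis"
    moreover have "T \<noteq> 0" using degT assms(3) by auto
    ultimately have "T = smult (lead_coeff T) ([:- (\<alpha> - poly f \<alpha>), 1:] ^ degree T)"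
      by (intro poly_single_root_eq_power) blast+
    from arg_cong[OF this, of pderiv]
    have "pderiv T = smult (lead_coeff T) (pderiv ([:- (\<alpha> - poly f \<alpha>), 1:] ^ degree T))"
      by (simp only: pderiv_smult)
    moreover have "of_nat (degree T) = (0 :: 'a)"
      using assms(2) by (simp add: degT of_nat_eq_0_iff_char_dvd)
    ultimately have "pderiv T = 0"
      by (simp only: pderiv_power smult_0_left mult_zero_left smult_0_right)
    moreover define W where "W = 2 * pderiv P * pcompose h P + P * pderiv (pcompose h P)"
    have "pderiv T = P * W + 1"
      unfolding T W_def
      by (simp add: pderiv_add pderiv_mult pderiv_pCons power2_eq_square algebra_simps)
    ultimately have "1 = P * - W"
      by (simp add: eq_neg_iff_add_eq_0 add.commute)
    then have "P dvd 1" by (rule dvdI)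
    then show False using degP by (auto simp: is_unit_poly_iff)
  qed
  then obtain c where c: "poly T c = 0" "c \<noteq> \<alpha> - poly f \<alpha>" by blast
  define g where "g = (\<lambda>x. poly f x + c)"
  have per: "(g ^^ n) \<alpha> = \<alpha>"
    using c(1) by (simp add: T_def poly_orbit_poly g_def del: orbit_poly.simps)
  have "(g ^^ k) \<alpha> \<in> (\<lambda>i. (g ^^ i) \<alpha>) ` {..<n}" for k
  proof (rule image_eqI)
    show "(g ^^ k) \<alpha> = (g ^^ (k mod n)) \<alpha>" using funpow_mod_eq[OF per] by simp
    show "k mod n \<in> {..<n}" by (simp add: n)
  qed
  then have "range (\<lambda>k. (g ^^ k) \<alpha>) \<subseteq> (\<lambda>i. (g ^^ i) \<alpha>) ` {..<n}"
    by (rule image_subsetI)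
  then have "preperiodic g \<alpha>"
    unfolding preperiodic_def by (rule finite_subset) (rule finite_imageI[OF finite_lessThan])
  then show "\<exists>c\<in>{c. preperiodic (\<lambda>x. poly f x + c) \<alpha>}.
      ((\<lambda>x. poly f x + c) ^^ n) \<alpha> = \<alpha> \<and> poly f \<alpha> + c \<noteq> \<alpha>"
    using per c(2) unfolding g_def by (intro bexI[of _ c]) (auto simp: eq_diff_eq add.commute)
next
  fix n n' :: nat and c :: 'a
  assume "prime n" "prime n'" "((\<lambda>x. poly f x + c) ^^ n) \<alpha> = \<alpha> \<and> poly f \<alpha> + c \<noteq> \<alpha>"
    "((\<lambda>x. poly f x + c) ^^ n') \<alpha> = \<alpha> \<and> poly f \<alpha> + c \<noteq> \<alpha>"
  then show "n = n'"
    using periodic_coprime_fixed[of n n' "\<lambda>x. poly f x + c" \<alpha>] primes_coprime_nat prime_gt_0_nat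
    by blast
qed

section \<open>The family of binomials\<close>

text \<open>The exponents are \<open>d\<^sub>1 = 2 q\<close> and \<open>d\<^sub>2 = q r\<close> for powers \<open>q\<close> and \<open>r\<close> of the characteristic.\<close>

locale binomial_map =
  fixes c1 c2 :: "'a::field" and l k q r :: nat
  assumes prime_CHAR: "prime CHAR('a)" and CHAR_not_2: "CHAR('a) \<noteq> 2"
    and q_eq: "q = CHAR('a) ^ l" and r_eq: "r = CHAR('a) ^ k" and r_ge: "r \<ge> 3"
    and c1: "c1 \<in> Fp_bar" "c1 \<noteq> 0" and c2: "c2 \<in> Fp_bar" "c2 \<noteq> 0"
begin

definition F :: "'a \<Rightarrow> 'a" where "F x = c2 * x ^ (q * r) + c1 * x ^ (2 * q)"

abbreviation prep :: "'a \<Rightarrow> 'a \<Rightarrow> bool" where "prep c \<equiv> preperiodic (\<lambda>x. F x + c)"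

lemma q_pos: "q > 0"
  using prime_gt_0_nat[OF prime_CHAR] by (simp add: q_eq)

lemma exponent_less: "2 * q < q * r" "1 < q * r"
proof -
  have "q * 3 \<le> q * r" using r_ge by simp
  then show "2 * q < q * r" "1 < q * r" using q_pos by linarith+
qed

lemma two_Fp_bar: "(2 :: 'a) \<in> Fp_bar" "(2 :: 'a) \<noteq> 0"
proof -
  show "(2 :: 'a) \<in> Fp_bar" using of_int_in_Fp_bar[of 2] by simp
  have "\<not> CHAR('a) dvd 2"
    using prime_CHAR CHAR_not_2 primes_dvd_imp_eq two_is_prime_nat by blast
  then show "(2 :: 'a) \<noteq> 0" using of_nat_eq_0_iff_char_dvd[of 2, where 'a = 'a] by simp
qed

lemma power_q_diff: "(x - y :: 'a) ^ q = x ^ q - y ^ q"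
  unfolding q_eq by (rule power_CHAR_power_diff[OF prime_CHAR])

lemma F_diff: "F x - F y = c2 * (x - y) ^ (q * r) + c1 * ((x - y) * (x + y)) ^ q"
proof -
  have 1: "(x - y) ^ (q * r) = x ^ (q * r) - y ^ (q * r)"
    unfolding q_eq r_eq power_add[symmetric] by (rule power_CHAR_power_diff[OF prime_CHAR])
  have "((x - y) * (x + y)) ^ q = (x\<^sup>2 - y\<^sup>2) ^ q"
    by (simp add: power2_eq_square algebra_simps)
  then have 2: "((x - y) * (x + y)) ^ q = x ^ (2 * q) - y ^ (2 * q)"
    by (simp add: power_q_diff power_mult)
  show ?thesis unfolding F_def 1 2 by (simp add: right_diff_distrib)
qed

lemma prep_next: "prep c x \<Longrightarrow> prep c (F x + c)"
  using preperiodic_step[of "\<lambda>x. F x + c" x] by simp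

lemma prep_orbit: "prep c x \<Longrightarrow> prep c (((\<lambda>x. F x + c) ^^ n) x)"
  by (induction n) (auto intro: prep_next)

end

text \<open>Index set of the Vandermonde product of four parameters.\<close>

definition pairs :: "(nat \<times> nat) set" where
  "pairs = {(0, 1), (0, 2), (0, 3), (1, 2), (1, 3), (2, 3)}"

section \<open>Local estimates at one valuation ring\<close>

locale binomial_place = binomial_map c1 c2 l k q r + valuation_ring V
  for c1 c2 :: "'a::field" and l k q r and V :: "'a set"
begin

lemmas unit1 = Fp_bar_unit[OF prime_CHAR c1]
lemmas unit2 = Fp_bar_unit[OF prime_CHAR c2]
lemmas unit_two = Fp_bar_unit[OF prime_CHAR two_Fp_bar]

text \<open>The coefficients have absolute value 1 and \<open>2 q < q r\<close>, so the top term
  governs. With \<open>F_large\<close> this yields \<open>|F x| = |x|^(q r)\<close> once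
  \<open>|x| > 1\<close>.\<close>

lemma F_le: "le x y \<Longrightarrow> le 1 y \<Longrightarrow> le (F x) (y ^ (q * r))"
proof -
  assume xy: "le x y" "le 1 y"
  have "le (x ^ (2 * q)) (y ^ (q * r))"
    using le_trans[OF le_power[OF xy(1)] le_power_exponent[OF xy(2)]] exponent_less by simp
  then show ?thesis
    unfolding F_def
    by (intro le_add) (simp_all add: le_unit_mult[OF unit1] le_unit_mult[OF unit2] le_power xy)
qed

lemma F_lt: "lt x y \<Longrightarrow> lt 1 y \<Longrightarrow> lt (F x) (y ^ (q * r))"
proof -
  assume xy: "lt x y" "lt 1 y"
  have "lt (x ^ (2 * q)) (y ^ (q * r))"
    using le_lt_trans[OF le_power[OF lt_imp_le[OF xy(1)]] lt_power_exponent[OF xy(2)]] exponent_less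
    by simp
  moreover have "lt (x ^ (q * r)) (y ^ (q * r))"
    using exponent_less by (intro lt_power xy) simp
  ultimately show ?thesis
    unfolding F_def by (intro lt_add) (simp_all add: lt_unit_mult[OF unit1] lt_unit_mult[OF unit2])
qed

lemma F_large: "lt 1 x \<Longrightarrow> le (x ^ (q * r)) (F x)"
proof -
  assume x: "lt 1 x"
  have "lt (c1 * x ^ (2 * q)) (c2 * x ^ (q * r))"
    using lt_power_exponent[OF x exponent_less(1)]
    by (simp add: lt_unit_mult[OF unit1] lt_mult_unit[OF unit2])
  from le_add_dominant[OF this] show ?thesis
    by (simp add: F_def add.commute le_unit_mult[OF unit2])
qed

text \<open>The next point has size at least \<open>|x|^(q r) > |x|\<close>, so both assumptions
  persist and the sizes increase along the whole orbit.\<close>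

lemma escape:
  assumes "lt 1 x" "lt c (x ^ (q * r))"
  shows "\<not> prep c x"
proof -
  define s where "s = (\<lambda>n. ((\<lambda>x. F x + c) ^^ n) x)"
  have step: "lt y (F y + c) \<and> lt 1 (F y + c) \<and> lt c ((F y + c) ^ (q * r))"
    if y: "lt 1 y" "lt c (y ^ (q * r))" for y
  proof -
    have "le (F y) (c + F y)"
      by (rule le_add_dominant[OF lt_le_trans[OF y(2) F_large[OF y(1)]]])
    then have "le (y ^ (q * r)) (F y + c)"
      using le_trans[OF F_large[OF y(1)]] by (simp add: add.commute)
    with lt_power_exponent[OF y(1) exponent_less(2)] have *: "lt y (F y + c)"
      using lt_le_trans by simp
    show ?thesis
      using * lt_trans[OF y(1) *] lt_le_trans[OF y(2) le_power[OF lt_imp_le[OF *]]] by blast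
  qed
  have "lt 1 (s n) \<and> lt c (s n ^ (q * r))" for n
    by (induction n) (use assms step in \<open>auto simp: s_def\<close>)
  then have "lt (s n) (s (Suc n))" for n
    using step by (simp add: s_def)
  then show ?thesis
    using lt_sequence_infinite[of s] by (simp add: preperiodic_def s_def)
qed

lemma prep_bound: "prep c x \<Longrightarrow> le x 1 \<or> le (x ^ (q * r)) c"
  using escape[of x c] by (auto simp: lt_def)

text \<open>Here \<open>c\<close> dominates, so the next point has size at least
  \<open>|c| > 1\<close>, and \<open>|c| < |c|^(q r)\<close> brings it into the scope of
  \<open>escape\<close>.\<close>

lemma large_parameter_escape:
  assumes "lt 1 c" "lt (F x) c"
  shows "\<not> prep c x"
proof
  assume "prep c x"
  then have P: "prep c (F x + c)" by (rule prep_next)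
  have cy: "le c (F x + c)" by (rule le_add_dominant[OF assms(2)])
  have "lt c ((F x + c) ^ (q * r))"
    using lt_le_trans[OF lt_power_exponent[OF assms(1) exponent_less(2)] le_power[OF cy]] by simp
  then show False using escape P lt_le_trans[OF assms(1) cy] by blast
qed

lemma parameter_integral: "prep c x \<Longrightarrow> le x 1 \<Longrightarrow> le c 1"
  using large_parameter_escape[of c x] F_le[of x 1] le_lt_trans[of "F x" 1 c] by (auto simp: lt_def)

lemma parameter_size:
  assumes "prep c x" "lt 1 x"
  shows "le c (x ^ (q * r))" "le (x ^ (q * r)) c"
proof -
  show "le (x ^ (q * r)) c" using prep_bound[OF assms(1)] assms(2) by (auto simp: lt_def)
  show "le c (x ^ (q * r))"
  proof (rule ccontr)
    assume "\<not> le c (x ^ (q * r))"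
    then have *: "lt (x ^ (q * r)) c" by (simp add: lt_def)
    have "lt 1 c" using lt_trans[OF one_lt_power[OF assms(2)] *] exponent_less by simp
    moreover have "lt (F x) c" using le_lt_trans[OF F_le[OF le_refl lt_imp_le[OF assms(2)]] *] .
    ultimately show False using large_parameter_escape assms(1) by blast
  qed
qed

context
  fixes a c
  assumes a: "lt 1 a" and ca: "prep c a"
begin

text \<open>By \<open>parameter_size\<close>, \<open>|c| = |a|^(q r)\<close>. A larger point would
  contradict \<open>prep_bound\<close>, and the image of a smaller one would be dominated by
  \<open>c\<close>.\<close>

lemma point_size:
  assumes "prep c x"
  shows "le x a" "le a x"
proof -
  note c = parameter_size[OF ca a]
  have qr: "q * r > 0" using exponent_less by simp
  show "le x a"
    using prep_bound[OF assms]
  proof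
    assume "le x 1"
    then show ?thesis using le_trans[OF _ lt_imp_le[OF a]] by blast
  next
    assume "le (x ^ (q * r)) c"
    then show ?thesis using le_trans[OF _ c(1)] le_power_iff[OF qr] by blast
  qed
  show "le a x"
  proof (rule ccontr)
    assume "\<not> le a x"
    then have "lt (F x) (a ^ (q * r))" using F_lt a by (simp add: lt_def)
    then have "lt (F x) c" by (rule lt_le_trans) (rule c(2))
    moreover have "lt 1 c" using lt_le_trans[OF one_lt_power[OF a qr] c(2)] .
    ultimately show False using large_parameter_escape assms by blast
  qed
qed

text \<open>Otherwise the distance of the two orbits would grow for ever.\<close>

lemma prep_diff_bound:
  assumes "prep c x" "prep c y"
  shows "le ((x - y) ^ (r - 1)) a"
proof (rule ccontr)
  assume "\<not> ?thesis"
  then have D0: "lt a ((x - y) ^ (r - 1))" by (simp add: lt_def)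
  define g where "g = (\<lambda>x. F x + c)"
  define s where "s = (\<lambda>n. (g ^^ n) x - (g ^^ n) y)"
  have step: "lt (u - v) (g u - g v) \<and> lt a ((g u - g v) ^ (r - 1))"
    if uv: "prep c u" "prep c v" "lt a ((u - v) ^ (r - 1))" for u v
  proof -
    define D where "D = u - v"
    have D: "lt a (D ^ (r - 1))" using uv by (simp add: D_def)
    have D1: "lt 1 D"
    proof (rule ccontr)
      assume "\<not> lt 1 D"
      then have "le (D ^ (r - 1)) 1" using le_power[of D 1 "r - 1"] by (simp add: lt_def)
      then show False using le_trans[OF _ lt_imp_le[OF a]] D by (auto simp: lt_def)
    qed
    \<comment> \<open>Both points have size \<open>|a| < |D|^(r - 1)\<close>, so the term with
      exponent \<open>q r\<close> dominates in \<open>F_diff\<close>.\<close>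
    have "lt (u + v) (D ^ (r - 1))"
      using le_lt_trans[OF le_add[OF point_size(1)[OF uv(1)] point_size(1)[OF uv(2)]] D] .
    then have "lt (D * (u + v)) (D * D ^ (r - 1))"
      using lt_nonzero[OF D1] by (intro lt_mult_right) auto
    also have "D * D ^ (r - 1) = D ^ r" using r_ge by (simp flip: power_Suc)
    finally have "lt ((D * (u + v)) ^ q) (D ^ (q * r))"
      using lt_power[OF _ q_pos, of "D * (u + v)" "D ^ r"]
      by (simp add: mult.commute flip: power_mult)
    then have "lt (c1 * (D * (u + v)) ^ q) (c2 * D ^ (q * r))"
      by (simp add: lt_unit_mult[OF unit1] lt_mult_unit[OF unit2])
    from le_add_dominant[OF this] have "le (D ^ (q * r)) (g u - g v)"
      using F_diff[of u v] by (simp add: g_def D_def add.commute le_unit_mult[OF unit2])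
    then have *: "lt D (g u - g v)"
      using lt_le_trans[OF lt_power_exponent[OF D1 exponent_less(2)]] by simp
    then show ?thesis
      using lt_le_trans[OF D le_power[OF lt_imp_le[OF *]]] by (simp add: D_def)
  qed
  have prep_s: "prep c ((g ^^ n) x)" "prep c ((g ^^ n) y)" for n
    unfolding g_def by (rule prep_orbit[OF assms(1)], rule prep_orbit[OF assms(2)])
  have "lt a (s n ^ (r - 1))" for n
  proof (induction n)
    case 0
    then show ?case using D0 by (simp add: s_def)
  next
    case (Suc n)
    then show ?case using step[OF prep_s] by (simp add: s_def)
  qed
  then have "lt (s n) (s (Suc n))" for n
    using step[OF prep_s] by (simp add: s_def)
  then have "infinite (range s)" by (rule lt_sequence_infinite)
  moreover have "range s \<subseteq> (\<lambda>(u, v). u - v) ` (range (\<lambda>n. (g ^^ n) x) \<times> range (\<lambda>n. (g ^^ n) y))"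
    by (force simp: s_def)
  moreover have "finite (range (\<lambda>n. (g ^^ n) x))" "finite (range (\<lambda>n. (g ^^ n) y))"
    using assms by (simp_all add: preperiodic_def g_def)
  ultimately show False by (meson finite_SigmaI finite_imageI finite_subset)
qed

end

lemma root_bound_lt:
  assumes "lt 1 a" "le (w ^ (r - 1)) a"
  shows "lt w a"
proof (rule ccontr)
  assume "\<not> lt w a"
  then have "le (a ^ (r - 1)) (w ^ (r - 1))" by (intro le_power) (simp add: lt_def)
  then have "le (a ^ (r - 1)) (a ^ 1)" using le_trans assms(2) by simp
  then show False using le_power_exponent_iff[OF assms(1), of "r - 1" 1] r_ge by simp
qed

text \<open>Two points \<open>x, y\<close> of size \<open>|a|\<close> are moved apart to distance \<open>|(x - y) a|\<^sup>q\<close> unless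
  \<open>|x - y|\<^sup>r\<^sup>-\<^sup>1 \<ge> |a|\<close>.\<close>

lemma diff_expansion:
  assumes a: "lt 1 a" and x: "le a x" and w: "lt ((x - y) ^ (r - 1)) a"
    and img: "le ((F x - F y) ^ (r - 1)) a"
  shows "le (((x - y) * a) ^ (q * (r - 1))) a"
proof (cases "x = y")
  case True
  then show ?thesis using q_pos r_ge by (simp add: power_0_left)
next
  case False
  define w where "w = x - y"
  \<comment> \<open>\<open>x + y = 2 x - w\<close> with \<open>|w| < |a| \<le> |x|\<close> and 2 a
    unit, so nothing cancels in \<open>x + y\<close>.\<close>
  have "lt (- w) (2 * x)"
    using lt_le_trans[OF root_bound_lt[OF a lt_imp_le[OF w]] x]
    by (simp add: lt_mult_unit[OF unit_two] w_def del: minus_diff_eq)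
  from le_add_dominant[OF this] have "le x (x + y)"
    by (simp add: w_def le_unit_mult[OF unit_two])
  then have "le (w * a) (w * (x + y))" using le_mult[OF le_refl le_trans[OF x]] by blast
  then have S: "le ((w * a) ^ q) ((w * (x + y)) ^ q)" by (rule le_power)
  have "lt (w * w ^ (r - 1)) (w * a)"
    using False w by (intro lt_mult_right) (auto simp: w_def)
  then have "lt ((w * w ^ (r - 1)) ^ q) ((w * a) ^ q)" by (rule lt_power[OF _ q_pos])
  also have "w * w ^ (r - 1) = w ^ r" using r_ge by (simp flip: power_Suc)
  also have "(w ^ r) ^ q = w ^ (q * r)" by (simp add: mult.commute flip: power_mult)
  finally have "lt (w ^ (q * r)) ((w * (x + y)) ^ q)" using S by (rule lt_le_trans)
  then have "lt (c2 * w ^ (q * r)) (c1 * (w * (x + y)) ^ q)"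
    by (simp add: lt_unit_mult[OF unit2] lt_mult_unit[OF unit1])
  from le_add_dominant[OF this] have "le ((w * (x + y)) ^ q) (F x - F y)"
    using F_diff[of x y] by (simp add: w_def le_unit_mult[OF unit1])
  then have "le ((w * a) ^ q) (F x - F y)" using le_trans[OF S] by blast
  then have "le (((w * a) ^ q) ^ (r - 1)) ((F x - F y) ^ (r - 1))" by (rule le_power)
  then show ?thesis using le_trans[OF _ img] by (simp add: w_def power_mult)
qed

section \<open>Differences of parameters and of image points\<close>

context
  fixes \<alpha> c c'
  assumes \<alpha>: "lt 1 \<alpha>" and c\<alpha>: "prep c \<alpha>" and c'\<alpha>: "prep c' \<alpha>"
begin

text \<open>\<open>c - c'\<close> is the difference of \<open>f(\<alpha>) + c - \<alpha>\<close> and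
  \<open>f(\<alpha>) + c' - \<alpha>\<close>, and each of these separates two points preperiodic for
  the same parameter.\<close>

lemma parameter_diff_bound: "le ((c - c') ^ (r - 1)) \<alpha>"
proof -
  have "le (((F \<alpha> + c) - \<alpha>) ^ (r - 1)) \<alpha>" "le (((F \<alpha> + c') - \<alpha>) ^ (r - 1)) \<alpha>"
    using prep_diff_bound[OF \<alpha> c\<alpha> prep_next[OF c\<alpha>] c\<alpha>]
      prep_diff_bound[OF \<alpha> c'\<alpha> prep_next[OF c'\<alpha>] c'\<alpha>] .
  from power_diff_le[OF this] show ?thesis by simp
qed

text \<open>Second iterates are compared with \<alpha> in the same way; the leftover
  \<open>c - c'\<close> obeys the same bound.\<close>

lemma image_diff_bound: "le ((F (F \<alpha> + c) - F (F \<alpha> + c')) ^ (r - 1)) \<alpha>"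
proof -
  have "le ((F (F \<alpha> + c) + c - \<alpha>) ^ (r - 1)) \<alpha>" "le ((F (F \<alpha> + c') + c' - \<alpha>) ^ (r - 1)) \<alpha>"
    using prep_diff_bound[OF \<alpha> c\<alpha> prep_next[OF prep_next[OF c\<alpha>]] c\<alpha>]
      prep_diff_bound[OF \<alpha> c'\<alpha> prep_next[OF prep_next[OF c'\<alpha>]] c'\<alpha>] .
  from power_diff_le[OF power_diff_le[OF this] parameter_diff_bound] show ?thesis
    by (simp add: algebra_simps)
qed

lemma parameter_diff_gain:
  assumes "lt ((c - c') ^ (r - 1)) \<alpha>"
  shows "le (((c - c') * \<alpha>) ^ (q * (r - 1))) \<alpha>"
  using diff_expansion[OF \<alpha> point_size(2)[OF \<alpha> c\<alpha> prep_next[OF c\<alpha>]] _ image_diff_bound] assms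
  by simp

end

context
  fixes \<alpha> \<beta> c
  assumes \<alpha>: "lt 1 \<alpha>" and c\<alpha>: "prep c \<alpha>" and c\<beta>: "prep c \<beta>"
begin

lemma point_diff_bound: "le ((F \<alpha> - F \<beta>) ^ (r - 1)) \<alpha>"
  using prep_diff_bound[OF \<alpha> c\<alpha> prep_next[OF c\<alpha>] prep_next[OF c\<beta>]] by simp

lemma image_point_diff_bound: "le ((F (F \<alpha> + c) - F (F \<beta> + c)) ^ (r - 1)) \<alpha>"
  using prep_diff_bound[OF \<alpha> c\<alpha> prep_next[OF prep_next[OF c\<alpha>]] prep_next[OF prep_next[OF c\<beta>]]]
  by simp

lemma point_diff_gain:
  assumes "lt ((F \<alpha> - F \<beta>) ^ (r - 1)) \<alpha>"
  shows "le (((F \<alpha> - F \<beta>) * \<alpha>) ^ (q * (r - 1))) \<alpha>"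
  using diff_expansion[OF \<alpha> point_size(2)[OF \<alpha> c\<alpha> prep_next[OF c\<alpha>]] _ image_point_diff_bound] assms
  by simp

end

text \<open>The second difference of the second iterates of \<open>\<alpha>\<close> and \<open>\<beta>\<close> in the parameters \<open>c\<close> and \<open>c'\<close>
  is \<open>c\<^sub>1 (2 (f(\<alpha>) - f(\<beta>)) (c - c'))\<^sup>q\<close>, because the exponent \<open>q r\<close> is additive and the exponent
  \<open>2 q\<close> is a Frobenius twist of the square.\<close>

lemma point_or_parameter_diff_small:
  assumes \<alpha>: "lt 1 \<alpha>" and c: "prep c \<alpha>" "prep c \<beta>" and c': "prep c' \<alpha>" "prep c' \<beta>"
  shows "lt ((F \<alpha> - F \<beta>) ^ (r - 1)) \<alpha> \<or> lt ((c - c') ^ (r - 1)) \<alpha>"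
proof (rule ccontr)
  define D where "D = F \<alpha> - F \<beta>"
  define e where "e = c - c'"
  assume "\<not> ?thesis"
  then have "le (\<alpha> * \<alpha>) (D ^ (r - 1) * e ^ (r - 1))"
    by (intro le_mult) (simp_all add: lt_def D_def e_def)
  then have "le ((\<alpha> ^ 2) ^ q) (((D * e) ^ (r - 1)) ^ q)"
    by (intro le_power) (simp add: power_mult_distrib power2_eq_square)
  also have "((D * e) ^ (r - 1)) ^ q = ((D * e) ^ q) ^ (r - 1)"
    by (simp add: mult.commute flip: power_mult)
  finally have 1: "le (\<alpha> ^ (2 * q)) (((D * e) ^ q) ^ (r - 1))" by (simp add: power_mult)
  have "(F (F \<alpha> + c) - F (F \<beta> + c)) - (F (F \<alpha> + c') - F (F \<beta> + c'))
    = c1 * (D * (F \<alpha> + F \<beta> + 2 * c)) ^ q - c1 * (D * (F \<alpha> + F \<beta> + 2 * c')) ^ q"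
    unfolding F_diff by (simp add: D_def algebra_simps)
  also have "\<dots> = c1 * (D * (F \<alpha> + F \<beta> + 2 * c) - D * (F \<alpha> + F \<beta> + 2 * c')) ^ q"
    by (simp only: power_q_diff right_diff_distrib)
  also have "D * (F \<alpha> + F \<beta> + 2 * c) - D * (F \<alpha> + F \<beta> + 2 * c') = 2 * (D * e)"
    by (simp add: e_def algebra_simps)
  finally have "le ((c1 * (2 * (D * e)) ^ q) ^ (r - 1)) \<alpha>"
    using power_diff_le[OF image_point_diff_bound[OF \<alpha> c] image_point_diff_bound[OF \<alpha> c']] by simp
  moreover have "le ((D * e) ^ q) (c1 * (2 * (D * e)) ^ q)"
    using le_power[of "D * e" "2 * (D * e)" q]
    by (simp add: le_mult_unit[OF unit1] le_mult_unit[OF unit_two])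
  ultimately have "le (((D * e) ^ q) ^ (r - 1)) \<alpha>"
    using le_trans[OF le_power] by blast
  then have "le (\<alpha> ^ (2 * q)) (\<alpha> ^ 1)" using le_trans[OF 1] by simp
  then have "2 * q \<le> 1" unfolding le_power_exponent_iff[OF \<alpha>] .
  then show False using q_pos by simp
qed

text \<open>The bounds give \<open>|u w|\<close> at most \<open>|\<alpha>|\<close> to the power
  \<open>- 1 + (q + 1) / (q (r - 1))\<close>. A product of size at least 1 therefore forces
  \<open>q (r - 2) \<le> 1\<close>, that is, \<open>q = 1\<close> and \<open>r = 3\<close>.\<close>

lemma product_small:
  assumes \<alpha>: "lt 1 \<alpha>" and u: "le (u ^ (r - 1)) \<alpha>" and w: "le ((w * \<alpha>) ^ (q * (r - 1))) \<alpha>"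
    and generic: "\<not> (q = 1 \<and> r = 3)"
  shows "lt (u * w) 1"
proof (rule ccontr)
  assume "\<not> ?thesis"
  then have "le (1 * \<alpha>) ((u * w) * \<alpha>)" by (intro le_mult) (simp_all add: lt_def)
  then have "le (\<alpha> ^ (q * (r - 1))) ((u * (w * \<alpha>)) ^ (q * (r - 1)))"
    by (intro le_power) (simp add: mult.assoc)
  also have "(u * (w * \<alpha>)) ^ (q * (r - 1)) = (u ^ (r - 1)) ^ q * (w * \<alpha>) ^ (q * (r - 1))"
    by (simp add: power_mult_distrib mult.commute flip: power_mult)
  also have "le \<dots> (\<alpha> ^ q * \<alpha>)" by (intro le_mult le_power u w)
  finally have "le (\<alpha> ^ (q * (r - 1))) (\<alpha> ^ (q + 1))" by (simp add: mult.commute)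
  then have le: "q * (r - 1) \<le> q + 1" unfolding le_power_exponent_iff[OF \<alpha>] .
  obtain j where j: "r = j + 3" using r_ge le_Suc_ex[of 3 r] by (auto simp: add.commute)
  have "q * (j + 1) \<le> 1" using le by (simp add: j algebra_simps)
  then have "q = 1" "j = 0" using q_pos by (cases q; cases j; simp)+
  then show False using generic j by simp
qed

lemma prod_le: "(\<And>i. i \<in> A \<Longrightarrow> le (g i) (h i)) \<Longrightarrow> le (prod g A) (prod h A)"
  by (induction A rule: infinite_finite_induct) (auto intro: le_mult)

text \<open>The case \<open>q = 1\<close>, \<open>r = 3\<close>, in which \<open>|(f(\<alpha>) - f(\<beta>)) (c - c')| = 1\<close> is possible. Here the
  parameters fall into three classes of diameter less than \<open>|\<alpha>|\<^sup>1\<^sup>/\<^sup>2\<close>, since parameters at distance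
  \<open>|\<alpha>|\<^sup>1\<^sup>/\<^sup>2\<close> differ by an approximate root of \<open>c\<^sub>2 X\<^sup>2 + 2 c\<^sub>1 \<alpha>\<close>.\<close>

context
  assumes cubic: "q = 1" "r = 3"
begin

text \<open>The images of \<open>x\<close> and \<open>x'\<close> differ by \<open>e * G\<close>. As
  \<open>|e G|\<^sup>2\<close> is replaced by \<open>(e * G) ^ 2\<close>, of size at most
  \<open>|\<alpha>| \<le> |e ^ 2|\<close>, this forces \<open>|G| \<le> 1\<close>, while
  \<open>x + x'\<close> equals \<open>2 * \<alpha>\<close> up to an error smaller than
  \<alpha>.\<close>

lemma parameter_diff_class:
  assumes \<alpha>: "lt 1 \<alpha>" and c: "prep c \<alpha>" and c': "prep c' \<alpha>" and far: "le \<alpha> ((c - c') ^ 2)"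
  shows "lt (c2 * (c - c') ^ 2 + 2 * c1 * \<alpha>) \<alpha>"
proof -
  define x where "x = F \<alpha> + c"
  define x' where "x' = F \<alpha> + c'"
  define e where "e = c - c'"
  define G where "G = c2 * e ^ 2 + c1 * (x + x')"
  have e0: "e \<noteq> 0"
    using far lt_nonzero[OF lt_le_trans[OF \<alpha> far]] by (auto simp: e_def)
  have "F x - F x' = e * G"
    unfolding F_diff
    by (simp add: cubic G_def x_def x'_def e_def power2_eq_square power3_eq_cube algebra_simps)
  then have "le ((e * G) ^ 2) \<alpha>"
    using image_diff_bound[OF \<alpha> c c'] by (simp add: cubic x_def x'_def)
  then have "le (G ^ 2 * e ^ 2) (1 * e ^ 2)"
    using le_trans[OF _ far] by (simp add: e_def power_mult_distrib mult.commute)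
  then have "le (G ^ 2) (1 ^ 2)" using e0 le_mult_cancel[of "e ^ 2" "G ^ 2" 1] by simp
  then have "le G 1" using le_power_iff[of 2 G 1] by simp
  then have G: "lt G \<alpha>" using le_lt_trans \<alpha> by blast
  have "lt (x - \<alpha>) \<alpha>" "lt (x' - \<alpha>) \<alpha>"
    using root_bound_lt[OF \<alpha> prep_diff_bound[OF \<alpha> c prep_next[OF c] c]]
      root_bound_lt[OF \<alpha> prep_diff_bound[OF \<alpha> c' prep_next[OF c'] c']]
    by (simp_all add: x_def x'_def)
  then have "lt (c1 * ((x - \<alpha>) + (x' - \<alpha>))) \<alpha>"
    unfolding lt_unit_mult[OF unit1] by (rule lt_add)
  from lt_diff[OF G this] show ?thesis
    by (simp add: G_def e_def algebra_simps)
qed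

text \<open>Both squares nearly solve the same equation, so \<open>e ^ 2 - e' ^ 2\<close> is smaller
  than \<alpha>. Since \<open>e - e'\<close> is large, the other factor \<open>e + e'\<close> must
  be small.\<close>

lemma opposite_class:
  assumes \<alpha>: "lt 1 \<alpha>" and c: "prep c \<alpha>" and c': "prep c' \<alpha>" and c'': "prep c'' \<alpha>"
    and far: "le \<alpha> ((c - c') ^ 2)" "le \<alpha> ((c - c'') ^ 2)" "le \<alpha> ((c' - c'') ^ 2)"
  shows "lt (((c - c') + (c - c'')) ^ 2) \<alpha>"
proof (rule ccontr)
  define e where "e = c - c'"
  define e' where "e' = c - c''"
  assume "\<not> ?thesis"
  then have "le (\<alpha> * \<alpha>) ((e - e') ^ 2 * (e + e') ^ 2)"
    using far(3) power2_commute[of c' c''] by (intro le_mult) (simp_all add: lt_def e_def e'_def)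
  then have "le (\<alpha> ^ 2) (((e - e') * (e + e')) ^ 2)"
    by (simp only: power_mult_distrib power2_eq_square[of \<alpha>])
  then have "le \<alpha> ((e - e') * (e + e'))"
    by (simp add: le_power_iff)
  also have "(e - e') * (e + e') = e ^ 2 - e' ^ 2"
    by (simp add: power2_eq_square algebra_simps)
  finally have "le \<alpha> (e ^ 2 - e' ^ 2)" .
  moreover have "lt (c2 * (e ^ 2 - e' ^ 2)) \<alpha>"
    using lt_diff[OF parameter_diff_class[OF \<alpha> c c' far(1)] parameter_diff_class[OF \<alpha> c c'' far(2)]]
    by (simp add: e_def e'_def right_diff_distrib)
  ultimately show False by (simp add: lt_def le_mult_unit[OF unit2])
qed

text \<open>If all pairs were far apart, \<open>t 1\<close> and \<open>t 2\<close>, and likewise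
  \<open>t 1\<close> and \<open>t 3\<close>, would be opposite as seen from \<open>t 0\<close>.
  Subtracting makes \<open>t 2\<close> and \<open>t 3\<close> close.\<close>

lemma four_parameters_close_pair:
  assumes \<alpha>: "lt 1 \<alpha>" and t: "\<And>i. i < 4 \<Longrightarrow> prep (t i) \<alpha>"
  shows "\<exists>i j. i < j \<and> j < (4::nat) \<and> lt ((t i - t j) ^ 2) \<alpha>"
proof (rule ccontr)
  assume none: "\<not> ?thesis"
  then have far: "le \<alpha> ((t i - t j) ^ 2)" if "i < j" "j < 4" for i j
    using that by (auto simp: lt_def)
  have "lt (((t 0 - t 1) + (t 0 - t 2)) ^ 2) \<alpha>" "lt (((t 0 - t 1) + (t 0 - t 3)) ^ 2) \<alpha>"
    by (intro opposite_class \<alpha> t far; simp)+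
  then have "lt ((t 3 - t 2) ^ 2) \<alpha>"
    using power_diff_lt[of "(t 0 - t 1) + (t 0 - t 2)" 2 \<alpha> "(t 0 - t 1) + (t 0 - t 3)"] by simp
  then show False using far[of 2 3] power2_commute[of "t 2" "t 3"] by (simp add: lt_def)
qed

text \<open>Let \<open>D = F \<alpha> - F \<beta>\<close>. A small difference has size at most
  \<open>|\<alpha>|^(-1/2)\<close>, any other at most \<open>|\<alpha>|^(1/2)\<close>. If
  \<open>D\<close> is small, one of the six parameter differences is small too; if not, all six are.
  Either way the product has size at most \<open>|\<alpha>|^(-1/2)\<close>, and 5 is the only
  exponent of \<open>D\<close> for which these bounds suffice in both cases.\<close>

lemma product_small_cubic:
  assumes \<alpha>: "lt 1 \<alpha>" and t: "\<And>i. i < 4 \<Longrightarrow> prep (t i) \<alpha>" "\<And>i. i < 4 \<Longrightarrow> prep (t i) \<beta>"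
  shows "lt ((F \<alpha> - F \<beta>) ^ 5 * (\<Prod>(i, j)\<in>pairs. t i - t j)) 1"
proof (rule ccontr)
  define D where "D = F \<alpha> - F \<beta>"
  define e where "e = (\<lambda>(i, j). t i - t j)"
  define E where "E = prod e pairs"
  have \<alpha>0: "\<alpha> \<noteq> 0" using lt_nonzero[OF \<alpha>] .
  have pair: "i < 4" "j < 4" if "(i, j) \<in> pairs" for i j using that by (auto simp: pairs_def)
  have fin: "finite pairs" "card pairs = 6" by (simp_all add: pairs_def)
  \<comment> \<open>Here \<open>q (r - 1) = 2\<close>, so one factor \<alpha> cancels.\<close>
  have gain: "le (w ^ 2 * \<alpha>) 1" if "le ((w * \<alpha>) ^ (q * (r - 1))) \<alpha>" for w
  proof -
    have "le (w ^ 2 * \<alpha> * \<alpha>) (1 * \<alpha>)"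
      using that by (simp add: cubic power2_eq_square mult_ac)
    then show ?thesis using le_mult_cancel[OF \<alpha>0] by blast
  qed
  have ebound: "le (e z ^ 2) \<alpha>" if "z \<in> pairs" for z
    using that pair parameter_diff_bound[OF \<alpha> t(1) t(1), of "fst z" "snd z"]
    by (cases z) (auto simp: e_def cubic)
  have egain: "le (e z ^ 2 * \<alpha>) 1" if "z \<in> pairs" "lt (e z ^ 2) \<alpha>" for z
    using that pair gain[OF parameter_diff_gain[OF \<alpha> t(1) t(1), of "fst z" "snd z"]]
    by (cases z) (auto simp: e_def cubic)
  have key: "le ((D ^ 2) ^ 5 * (E ^ 2 * \<alpha> ^ 6)) (\<alpha> ^ 5)"
  proof (cases "lt (D ^ 2) \<alpha>")
    case True
    have D: "le (D ^ 2 * \<alpha>) 1"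
      unfolding D_def
      by (rule gain, rule point_diff_gain[OF \<alpha> t(1)[of 0] t(2)[of 0]])
        (use True in \<open>simp_all add: cubic D_def\<close>)
    obtain i j where ij: "i < j" "j < 4" "lt ((t i - t j) ^ 2) \<alpha>"
      using four_parameters_close_pair[of \<alpha> t, OF \<alpha> t(1)] by blast
    have z: "(i, j) \<in> pairs"
      using ij(1,2) by (auto simp: pairs_def less_Suc_eq numeral_eq_Suc)
    have "E ^ 2 * \<alpha> = (e (i, j) ^ 2 * \<alpha>) * (\<Prod>z\<in>pairs - {(i, j)}. e z ^ 2)"
      unfolding E_def prod_power_distrib using prod.remove[OF fin(1) z, of "\<lambda>z. e z ^ 2"] by simp
    also have "le \<dots> (1 * (\<Prod>z\<in>pairs - {(i, j)}. \<alpha>))"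
      using ij z by (intro le_mult prod_le egain ebound) (auto simp: e_def)
    also have "(\<Prod>z\<in>pairs - {(i, j)}. \<alpha>) = \<alpha> ^ 5"
      using z fin by simp
    finally have "le (E ^ 2 * \<alpha>) (\<alpha> ^ 5)" by simp
    then have "le ((D ^ 2 * \<alpha>) ^ 5 * (E ^ 2 * \<alpha>)) (1 ^ 5 * \<alpha> ^ 5)"
      by (intro le_mult le_power D)
    moreover have "\<alpha> ^ 6 = \<alpha> ^ 5 * \<alpha>" by (simp add: eval_nat_numeral)
    ultimately show ?thesis by (simp only: power_mult_distrib mult_ac power_one mult_1)
  next
    case False
    have "le (e z ^ 2 * \<alpha>) 1" if z: "z \<in> pairs" for z
    proof (rule egain[OF z])
      obtain i j where ij: "z = (i, j)" "i < 4" "j < 4" using z pair by (cases z) auto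
      then show "lt (e z ^ 2) \<alpha>"
        using point_or_parameter_diff_small[OF \<alpha> t(1) t(2) t(1) t(2), of i j] False
        by (simp add: e_def cubic D_def)
    qed
    then have "le (\<Prod>z\<in>pairs. e z ^ 2 * \<alpha>) (\<Prod>z\<in>pairs. 1)" by (rule prod_le)
    then have "le (E ^ 2 * \<alpha> ^ 6) 1"
      by (simp add: E_def prod.distrib prod_power_distrib fin)
    moreover have "le (D ^ 2) \<alpha>"
      using point_diff_bound[OF \<alpha> t(1)[of 0] t(2)[of 0]] by (simp add: D_def cubic)
    ultimately show ?thesis
      using le_mult[OF le_power, of "D ^ 2" \<alpha> "E ^ 2 * \<alpha> ^ 6" 1 5] by simp
  qed
  assume "\<not> lt ((F \<alpha> - F \<beta>) ^ 5 * (\<Prod>(i, j)\<in>pairs. t i - t j)) 1"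
  then have "le 1 (D ^ 5 * E)" by (simp add: lt_def D_def E_def e_def)
  then have "le (1 * \<alpha> ^ 6) ((D ^ 5 * E) ^ 2 * \<alpha> ^ 6)"
    by (intro le_mult one_le_power le_refl)
  also have "(D ^ 5 * E) ^ 2 * \<alpha> ^ 6 = (D ^ 2) ^ 5 * (E ^ 2 * \<alpha> ^ 6)"
    by (simp add: power_mult_distrib mult_ac flip: power_mult)
  finally have "le (\<alpha> ^ 6) (\<alpha> ^ 5)" using le_trans[OF _ key] by simp
  then show False unfolding le_power_exponent_iff[OF \<alpha>] by simp
qed

end

end

section \<open>From local estimates to equality of the images\<close>

lemma eq_0_if_small_at_poles:
  fixes X \<alpha> :: "'a::field"
  assumes p: "prime CHAR('a)" and \<alpha>: "\<alpha> \<notin> Fp_bar"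
    and integral: "\<And>V. valuation_ring V \<Longrightarrow> valuation_ring.le V \<alpha> 1 \<Longrightarrow> valuation_ring.le V X 1"
    and small: "\<And>V. valuation_ring V \<Longrightarrow> valuation_ring.lt V 1 \<alpha> \<Longrightarrow> valuation_ring.lt V X 1"
  shows "X = 0"
proof (rule ccontr)
  assume X0: "X \<noteq> 0"
  have "X \<in> V" if "is_valuation_ring V" for V
  proof -
    interpret valuation_ring V using that by unfold_locales
    show ?thesis
      unfolding in_iff_le_1
      using integral[OF valuation_ring_axioms] small[OF valuation_ring_axioms] lt_imp_le[of X 1]
      by (auto simp: lt_def)
  qed
  then have X: "X \<in> Fp_bar" by (rule Fp_bar_if_in_all_valuation_rings)
  obtain V where V: "is_valuation_ring V" "\<alpha> \<notin> V"
    using \<alpha> Fp_bar_if_in_all_valuation_rings by blast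
  interpret valuation_ring V using V by unfold_locales
  \<comment> \<open>At this pole of \<alpha> the nonzero algebraic element \<open>X\<close>, of
    absolute value 1, would be smaller than 1.\<close>
  have "lt X 1" using small[OF valuation_ring_axioms] V(2) by (simp add: lt_def in_iff_le_1)
  then show False using Fp_bar_unit(2)[OF p X X0] by (simp add: lt_def)
qed

lemma (in binomial_map) F_eq_if_infinite_prep:
  assumes \<alpha>: "\<alpha> \<notin> Fp_bar" and inf: "infinite {c. prep c \<alpha> \<and> prep c \<beta>}"
  shows "F \<alpha> = F \<beta>"
proof (rule ccontr)
  assume "F \<alpha> \<noteq> F \<beta>"
  then have D0: "F \<alpha> - F \<beta> \<noteq> 0" by simp
  \<comment> \<open>Only distinctness matters: two parameters suffice in general, four if
    \<open>q = 1\<close> and \<open>r = 3\<close>.\<close>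
  obtain t :: "nat \<Rightarrow> 'a" where t: "inj t" "range t \<subseteq> {c. prep c \<alpha> \<and> prep c \<beta>}"
    using infinite_countable_subset[OF inf] by blast
  then have prep_t: "prep (t i) \<alpha>" "prep (t i) \<beta>" for i by auto
  have integral: "valuation_ring.le V (F \<alpha> - F \<beta>) 1" "valuation_ring.le V (t i - t j) 1"
    if "valuation_ring V" "valuation_ring.le V \<alpha> 1" for V i j
  proof -
    interpret valuation_ring V by fact
    interpret binomial_place c1 c2 l k q r V by unfold_locales
    have ti: "le (t i) 1" for i using parameter_integral[OF prep_t(1) that(2)] .
    \<comment> \<open>A pole of \<beta> would give
      \<open>|t i| = |\<beta>|^(q r) > 1\<close>.\<close>
    have "le \<beta> 1"
    proof (rule ccontr)
      assume "\<not> le \<beta> 1"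
      then have b: "lt 1 \<beta>" by (simp add: lt_def)
      then have "lt 1 (\<beta> ^ (q * r))" using exponent_less by (intro one_lt_power) auto
      then show False
        using le_trans[OF parameter_size(2)[OF prep_t(2) b] ti] by (auto simp: lt_def)
    qed
    then show "le (F \<alpha> - F \<beta>) 1"
      using F_le[OF that(2)] F_le[of \<beta> 1] by (intro le_diff) auto
    show "le (t i - t j) 1" by (intro le_diff ti)
  qed
  show False
  proof (cases "q = 1 \<and> r = 3")
    case False
    have "(F \<alpha> - F \<beta>) * (t 0 - t 1) = 0"
    proof (rule eq_0_if_small_at_poles[OF prime_CHAR \<alpha>])
      fix V :: "'a set" assume V: "valuation_ring V"
      then interpret valuation_ring V .
      interpret binomial_place c1 c2 l k q r V by unfold_locales
      show "le ((F \<alpha> - F \<beta>) * (t 0 - t 1)) 1" if "le \<alpha> 1"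
        using le_mult[OF integral[OF V that]] by simp
      show "lt ((F \<alpha> - F \<beta>) * (t 0 - t 1)) 1" if a: "lt 1 \<alpha>"
        using point_or_parameter_diff_small[OF a prep_t prep_t, of 0 1]
      proof
        assume "lt ((F \<alpha> - F \<beta>) ^ (r - 1)) \<alpha>"
        from product_small[OF a parameter_diff_bound[OF a prep_t(1) prep_t(1)]
            point_diff_gain[OF a prep_t this] False]
        show ?thesis by (subst mult.commute)
      next
        assume "lt ((t 0 - t 1) ^ (r - 1)) \<alpha>"
        from product_small[OF a point_diff_bound[OF a prep_t]
            parameter_diff_gain[OF a prep_t(1) prep_t(1) this] False]
        show ?thesis .
      qed
    qed
    moreover have "t 0 \<noteq> t 1" using t(1) by (simp add: inj_eq)
    ultimately show False using D0 by simp
  next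
    case True
    have "(F \<alpha> - F \<beta>) ^ 5 * (\<Prod>(i, j)\<in>pairs. t i - t j) = 0"
    proof (rule eq_0_if_small_at_poles[OF prime_CHAR \<alpha>])
      fix V :: "'a set" assume V: "valuation_ring V"
      then interpret valuation_ring V .
      interpret binomial_place c1 c2 l k q r V by unfold_locales
      show "le ((F \<alpha> - F \<beta>) ^ 5 * (\<Prod>(i, j)\<in>pairs. t i - t j)) 1" if a: "le \<alpha> 1"
      proof -
        have "le (\<Prod>(i, j)\<in>pairs. t i - t j) (\<Prod>z\<in>pairs. 1)"
          by (rule prod_le) (use integral(2)[OF V a] in auto)
        then show ?thesis using le_mult[OF le_power[OF integral(1)[OF V a], of 5]] by simp
      qed
      show "lt ((F \<alpha> - F \<beta>) ^ 5 * (\<Prod>(i, j)\<in>pairs. t i - t j)) 1" if "lt 1 \<alpha>"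
        using True that prep_t by (intro product_small_cubic) auto
    qed
    moreover have "(\<Prod>(i, j)\<in>pairs. t i - t j) \<noteq> 0"
      using t(1) by (simp add: pairs_def inj_eq)
    ultimately show False using D0 by simp
  qed
qed

theorem theorem4p1:
  fixes p :: nat and L :: "'k::alg_closed_field set"
    and c1 c2 \<alpha> \<beta> :: 'k and d1 d2 l1 l2 s1 s2 :: nat and f :: "'k poly"
  assumes "prime p"
    and "CHAR('k) = p"
    and "algebraic_closure_of L"
    and "c1 \<in> Fp_bar" and "c1 \<noteq> 0"
    and "c2 \<in> Fp_bar" and "c2 \<noteq> 0"
    and "1 \<le> d1" and "d1 < d2"
    and "f = monom c1 d1 + monom c2 d2"
    and "d1 = p ^ l1 * s1" and "\<not> p dvd s1"
    and "d2 = p ^ l2 * s2" and "\<not> p dvd s2"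
    and "(s1, s2) = (2, 1)"
    and "\<alpha> \<in> L" and "\<beta> \<in> L"
  shows "infinite (Prep f \<alpha> \<beta>) \<longleftrightarrow>
    (\<alpha> \<in> Fp_bar \<and> \<beta> \<in> Fp_bar) \<or> poly f \<alpha> = poly f \<beta>"
proof -
  have p: "prime CHAR('k)" and p_eq: "p = CHAR('k)" using assms(1,2) by auto
  have s: "s1 = 2" "s2 = 1" using assms(15) by auto
  have p2: "p \<noteq> 2" using assms(12) s by auto
  define q where "q = p ^ l1"
  define r where "r = p ^ (l2 - l1)"
  have lt: "p ^ l1 * 2 < p ^ l2" using assms(9,11,13) s by simp
  have l: "l1 < l2"
  proof (rule ccontr)
    assume "\<not> l1 < l2"
    then have "p ^ l2 \<le> p ^ l1" using prime_gt_0_nat[OF assms(1)] by (intro power_increasing) auto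
    then show False using lt by simp
  qed
  have d1: "d1 = 2 * q" using assms(11) s by (simp add: q_def)
  have d2: "d2 = q * r"
    using assms(13) s l by (simp add: q_def r_def flip: power_add)
  have "q * 2 < q * r" using assms(9) unfolding d1 d2 by simp
  then have r: "r \<ge> 3" by simp
  interpret binomial_map c1 c2 l1 "l2 - l1" q r
    using p p2 r assms(4-7) by unfold_locales (simp_all add: q_def r_def p_eq)
  have f: "poly f x = F x" for x
    by (simp add: assms(10) poly_monom F_def d1 d2)
  have Prep: "Prep f \<alpha> \<beta> = {c. prep c \<alpha> \<and> prep c \<beta>}"
    by (simp add: Prep_def f)
  show ?thesis
  proof
    assume inf: "infinite (Prep f \<alpha> \<beta>)"
    show "(\<alpha> \<in> Fp_bar \<and> \<beta> \<in> Fp_bar) \<or> poly f \<alpha> = poly f \<beta>"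
    proof (rule ccontr)
      assume *: "\<not> ?thesis"
      then have "F \<alpha> \<noteq> F \<beta>" by (simp add: f)
      \<comment> \<open>The situation is symmetric, so each of the two points is ruled out as
        transcendental separately.\<close>
      then have "\<alpha> \<in> Fp_bar" "\<beta> \<in> Fp_bar"
        using F_eq_if_infinite_prep[of \<alpha> \<beta>] F_eq_if_infinite_prep[of \<beta> \<alpha>] inf
        by (auto simp: Prep conj_commute)
      then show False using * by blast
    qed
  next
    assume "(\<alpha> \<in> Fp_bar \<and> \<beta> \<in> Fp_bar) \<or> poly f \<alpha> = poly f \<beta>"
    then show "infinite (Prep f \<alpha> \<beta>)"
    proof
      assume "\<alpha> \<in> Fp_bar \<and> \<beta> \<in> Fp_bar"
      then have "Fp_bar \<subseteq> Prep f \<alpha> \<beta>"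
        using preperiodic_Fp_bar[OF p assms(4,6)] by (auto simp: Prep_def assms(10))
      then show ?thesis using infinite_Fp_bar[OF p] infinite_super by blast
    next
      assume eq: "poly f \<alpha> = poly f \<beta>"
      \<comment> \<open>The two orbits merge after one step, which leaves a condition on \<alpha>
        alone.\<close>
      have "prep c \<beta> \<longleftrightarrow> prep c \<alpha>" for c
        using eq preperiodic_step[of "\<lambda>x. F x + c" \<alpha>] preperiodic_step[of "\<lambda>x. F x + c" \<beta>]
        by (simp add: f)
      then have "Prep f \<alpha> \<beta> = {c. preperiodic (\<lambda>x. poly f x + c) \<alpha>}"
        by (simp add: Prep f)
      moreover have "[:0, 1:] ^ 2 dvd f"
      proof -
        have X2: "[:0, 1:] ^ 2 = (monom 1 2 :: 'k poly)"
          by (simp add: power2_eq_square monom_altdef)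
        have "monom 1 2 dvd monom c d" if "d \<ge> 2" for c :: 'k and d
          using that
          by (intro dvdI[of _ _ "monom c (d - 2)"]) (simp add: mult_monom del: add_2_eq_Suc)
        then show ?thesis
          unfolding X2 assms(10) using q_pos assms(9) by (intro dvd_add) (auto simp: d1)
      qed
      moreover have deg: "degree f = d2"
        using assms(5,7,9) unfolding assms(10)
        by (subst degree_add_eq_right) (auto simp: degree_monom_eq)
      moreover have "p dvd d2" using assms(13) s l by (simp add: dvd_power)
      moreover have "d2 > 1" using exponent_less d2 by simp
      ultimately show ?thesis
        using infinite_preperiodic_parameters[of f \<alpha>] p_eq by simp
    qed
  qed
qed

end
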